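(* Let $q$ be a fixed prime power. The $n\to\infty$ limit of the probability that a uniformly random matrix in $Mat(n,q)$ is regular is $$\left(1-\frac{1}{q^5}\right)\prod_{r=3}^{\infty}\left(1-\frac{1}{q^r}\right).$$
   Context: $Mat(n,q)$ is the set of all $n\times n$ matrices over the finite field $F_q$. By rational canonical form, a matrix $\alpha\in Mat(n,q)$ determines for each monic non-constant irreducible polynomial $\phi$ over $F_q$ a partition $\lambda_\phi(\alpha)$ with parts $\lambda_{\phi,1}\ge\lambda_{\phi,2}\ge\cdots$, such that $F_q^n$, as an $F_q[z]$-module with $z$ acting as $\alpha$, is isomorphic to $\bigoplus_\phi\bigoplus_j F_q[z]/(\phi^{\lambda_{\phi,j}})$. A matrix $\alpha\in Mat(n,q)$ is called regular if every $\lambda_\phi(\alpha)$ has at most one part (equivalently, the minimal polynomial of $\alpha$ equals its characteristic polynomial). *)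

theory Defs
  imports
    "Jordan_Normal_Form.Matrix"
    "HOL-Computational_Algebra.Computational_Algebra"
    "HOL-Probability.Probability_Mass_Function"
    "HOL-Analysis.Infinite_Products"
begin

(* Both HOL-Analysis and Jordan_Normal_Form declare a type vec, a postfix $, etc.
   Jordan_Normal_Form's are the ones meant here. *)

definition irred_monic :: "'a::field poly set" where
  "irred_monic = {\<phi>. irreducible \<phi> \<and> lead_coeff \<phi> = 1}"

definition is_partition :: "nat list \<Rightarrow> bool" where
  "is_partition l \<longleftrightarrow> sorted_wrt (\<ge>) l \<and> (\<forall>k \<in> set l. 0 < k)"

(* The F[z]-module structure on F^n in which z acts as A:  p . v = (SUM k. coeff p k * A^k v). *)
definition poly_act :: "'a::field mat \<Rightarrow> 'a poly \<Rightarrow> 'a Matrix.vec \<Rightarrow> 'a Matrix.vec" where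
  "poly_act A p v =
     Matrix.vec (dim_row A)
       (\<lambda>i. \<Sum>k\<le>degree p. coeff p k * Matrix.vec_index ((A ^\<^sub>m k) *\<^sub>v v) i)"

(* The F[z]-module (DSUM \<phi> j. F[z]/(\<phi>^(lam \<phi> ! j))).  It is indexed by the pairs (\<phi>, j) with \<phi>
   monic irreducible and j < length (lam \<phi>); a residue class modulo \<phi>^k is represented by
   its unique member f with f mod \<phi>^k = f.  Sums of representatives are again
   representatives, so addition is pointwise. *)
definition primary_index :: "('a::field poly \<Rightarrow> nat list) \<Rightarrow> ('a poly \<times> nat) set" where
  "primary_index lam = (SIGMA \<phi>:irred_monic. {..<length (lam \<phi>)})"

definition primary_modulus :: "('a::field poly \<Rightarrow> nat list) \<Rightarrow> 'a poly \<times> nat \<Rightarrow> 'a poly" where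
  "primary_modulus lam = (\<lambda>(\<phi>, j). \<phi> ^ (lam \<phi> ! j))"

definition primary_sum :: "('a::field poly \<Rightarrow> nat list) \<Rightarrow> ('a poly \<times> nat \<Rightarrow> 'a poly) set" where
  "primary_sum lam =
     {f. finite {i. f i \<noteq> 0} \<and>
         (\<forall>i \<in> primary_index lam. f i mod primary_modulus lam i = f i) \<and>
         (\<forall>i. i \<notin> primary_index lam \<longrightarrow> f i = 0)}"

definition primary_add ::
  "('a::field poly \<times> nat \<Rightarrow> 'a poly) \<Rightarrow> ('a poly \<times> nat \<Rightarrow> 'a poly) \<Rightarrow> 'a poly \<times> nat \<Rightarrow> 'a poly" where
  "primary_add f g = (\<lambda>i. f i + g i)"

definition primary_smult ::
  "('a::field poly \<Rightarrow> nat list) \<Rightarrow> 'a poly \<Rightarrow> ('a poly \<times> nat \<Rightarrow> 'a poly) \<Rightarrow> 'a poly \<times> nat \<Rightarrow> 'a poly" where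
  "primary_smult lam p f =
     (\<lambda>i. if i \<in> primary_index lam then (p * f i) mod primary_modulus lam i else 0)"

(* lam is the family of partitions (\<lambda>_\<phi>(A))_\<phi> of the square matrix A: each lam \<phi> is a partition
   and F^n, with z acting as A, is isomorphic as an F[z]-module to the direct sum above.
   Values of lam outside irred_monic are irrelevant.  By the rational canonical form theorem
   such a lam exists and is unique on irred_monic. *)
definition canonical_partitions :: "'a::field mat \<Rightarrow> ('a poly \<Rightarrow> nat list) \<Rightarrow> bool" where
  "canonical_partitions A lam \<longleftrightarrow>
     (\<forall>\<phi> \<in> irred_monic. is_partition (lam \<phi>)) \<and>
     (\<exists>h. bij_betw h (carrier_vec (dim_row A)) (primary_sum lam) \<and>
          (\<forall>v \<in> carrier_vec (dim_row A). \<forall>w \<in> carrier_vec (dim_row A).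
             h (v + w) = primary_add (h v) (h w)) \<and>
          (\<forall>p. \<forall>v \<in> carrier_vec (dim_row A).
             h (poly_act A p v) = primary_smult lam p (h v)))"

definition regular_mat :: "'a::field mat \<Rightarrow> bool" where
  "regular_mat A \<longleftrightarrow>
     (\<exists>lam. canonical_partitions A lam \<and> (\<forall>\<phi> \<in> irred_monic. length (lam \<phi>) \<le> 1))"

end

theory Submission
  imports Defs "Jordan_Normal_Form.Determinant"
begin

text \<open>
  A matrix is regular iff it has a cyclic vector \<open>v\<close>.  A pair \<open>(A, v)\<close> with \<open>v\<close> cyclic and minimal
  polynomial \<open>f\<close> is the same thing as the invertible matrix with columns \<open>v, A v, A\<^sup>2 v, \<dots>\<close>, and a
  matrix with minimal polynomial \<open>f\<close> has as many cyclic vectors as there are units modulo \<open>f\<close>.  Hence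
  the number of regular matrices is \<open>|GL(n,q)|\<close> times the sum of \<open>1 / \<Phi>(f)\<close> over the monic \<open>f\<close> of
  degree \<open>n\<close>, where \<open>\<Phi>(f) = |f| \<Prod> (1 - 1/|\<phi>|)\<close> over the irreducible factors \<open>\<phi>\<close> of \<open>f\<close> and
  \<open>|f| = q ^ deg f\<close>.  Expanding \<open>|f| / \<Phi>(f) = \<Prod> (1 + 1/(|\<phi>| - 1))\<close> and interchanging sums turns
  this into the sum of \<open>\<Prod>\<phi>\<in>S. 1 / (|\<phi>| (|\<phi>| - 1))\<close> over the finite sets \<open>S\<close> of irreducibles of
  total degree at most \<open>n\<close>, whose limit is the Euler product of the factors
  \<open>1 + 1/(x (x - 1)) = (1 - x\<^sup>-\<^sup>6) / ((1 - x\<^sup>-\<^sup>2) (1 - x\<^sup>-\<^sup>3))\<close> at \<open>x = |\<phi>|\<close>.  As the zeta function of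
  \<open>F_q[z]\<close> is \<open>1 / (1 - q\<^sup>1\<^sup>-\<^sup>s)\<close>, this is \<open>(1 - q\<^sup>-\<^sup>5) / ((1 - q\<^sup>-\<^sup>1) (1 - q\<^sup>-\<^sup>2))\<close>.
\<close>

unbundle no vec_syntax
no_notation fps_nth (infixl "$" 75)
hide_const (open) Finite_Cartesian_Product.vec Finite_Cartesian_Product.row Finite_Cartesian_Product.mat
hide_type (open) Finite_Cartesian_Product.vec

section \<open>Polynomials over a field\<close>

lemma irred_monicD:
  assumes "\<phi> \<in> irred_monic"
  shows "irreducible \<phi>" "lead_coeff \<phi> = 1" "\<phi> \<noteq> 0" "degree \<phi> > 0" "prime_elem \<phi>"
proof -
  show 1: "irreducible \<phi>" "lead_coeff \<phi> = 1" using assms by (auto simp: irred_monic_def)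
  then show "\<phi> \<noteq> 0" by auto
  with 1 show "degree \<phi> > 0" using is_unit_iff_degree[of \<phi>] by (auto simp: irreducible_def)
  from 1 show "prime_elem \<phi>" by (intro field_poly_irreducible_imp_prime)
qed

text \<open>Induction on the degree: an irreducible polynomial is rescaled by its leading
  coefficient, and a reducible one has a nonconstant factor of smaller degree.\<close>

lemma exists_irred_monic_dvd:
  fixes p :: "'a::field poly"
  assumes "degree p > 0"
  shows "\<exists>\<phi>\<in>irred_monic. \<phi> dvd p"
  using assms
proof (induction "degree p" arbitrary: p rule: less_induct)
  case less
  show ?case
  proof (cases "irreducible p")
    case True
    have "p \<noteq> 0" using less.prems by auto
    let ?c = "inverse (lead_coeff p)"
    have c: "?c \<noteq> 0" using \<open>p \<noteq> 0\<close> by simp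
    have "irreducible (smult ?c p)"
      using True c irreducible_mult_unit_left[of "[:?c:]" p] by (simp add: is_unit_const_poly_iff dvd_field_iff)
    moreover have "lead_coeff (smult ?c p) = 1" using \<open>p \<noteq> 0\<close> by simp
    ultimately have "smult ?c p \<in> irred_monic" by (simp add: irred_monic_def)
    moreover have "smult ?c p dvd p" using c by (simp add: smult_dvd_iff)
    ultimately show ?thesis by blast
  next
    case False
    have "p \<noteq> 0" using less.prems by auto
    then have p0: "p \<noteq> 0" "\<not> is_unit p" using less.prems is_unit_iff_degree[of p] by auto
    then obtain a b where ab: "p = a * b" "\<not> is_unit a" "\<not> is_unit b"
      using False by (auto simp: irreducible_def)
    then have "a \<noteq> 0" "b \<noteq> 0" using p0 by auto
    then have "degree a > 0" "degree a < degree p" using ab is_unit_iff_degree by (auto simp: degree_mult_eq)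
    then show ?thesis using less.hyps[of a] ab(1) by (auto intro: dvd_mult2)
  qed
qed

section \<open>Bezout identities and coprimality\<close>

lemma coprime_poly_imp_bezout:
  fixes p q :: "'a::field poly"
  assumes "coprime p q"
  shows "\<exists>a b. a * p + b * q = 1"
proof -
  \<comment> \<open>An element of least degree in this set divides every combination of
    \<open>p\<close> and \<open>q\<close>, because the remainder is again a combination. Being a
    common divisor, it is a unit.\<close>
  let ?I = "{d. d \<noteq> 0 \<and> (\<exists>a b. d = a * p + b * q)}"
  have "p \<noteq> 0 \<or> q \<noteq> 0" using assms by auto
  moreover have "p = 1 * p + 0 * q" "q = 0 * p + 1 * q" by auto
  ultimately have "?I \<noteq> {}" by blast
  then obtain d where d: "d \<in> ?I" and min: "\<And>e. e \<in> ?I \<Longrightarrow> degree d \<le> degree e"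
    using ex_has_least_nat[of "\<lambda>d. d \<in> ?I" _ degree] by (metis (no_types, lifting) ex_in_conv)
  from d obtain a b where ab: "d = a * p + b * q" and d0: "d \<noteq> 0" by blast
  have dvd: "d dvd r" if r: "r = u * p + v * q" for r u v
  proof (rule ccontr)
    assume "\<not> d dvd r"
    then have n0: "r mod d \<noteq> 0" by (simp add: mod_eq_0_iff_dvd)
    have "r mod d = r - r div d * d" by (simp add: minus_div_mult_eq_mod)
    also have "\<dots> = (u - r div d * a) * p + (v - r div d * b) * q"
      unfolding r ab by (simp add: algebra_simps)
    finally have "r mod d \<in> ?I" using n0 by blast
    from min[OF this] show False using degree_mod_less'[OF d0 n0] by simp
  qed
  have "d dvd p" "d dvd q" using dvd[of p 1 0] dvd[of q 0 1] by auto
  with assms have "is_unit d" by (auto simp: coprime_def)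
  then obtain e where "1 = d * e" by (auto simp: dvd_def)
  then have "(e * a) * p + (e * b) * q = 1" unfolding ab by (simp add: algebra_simps)
  then show ?thesis by blast
qed

lemma bezout_imp_coprime_poly:
  fixes p q :: "'a::field poly"
  assumes "a * p + b * q = 1"
  shows "coprime p q"
proof (rule coprimeI)
  fix c assume "c dvd p" "c dvd q"
  then have "c dvd a * p + b * q" by (intro dvd_add dvd_mult)
  then show "is_unit c" using assms by simp
qed

lemma coprime_mult_poly:
  fixes p q r :: "'a::field poly"
  assumes "coprime p r" "coprime q r"
  shows "coprime (p * q) r"
proof -
  obtain a b c d where 1: "a * p + b * r = 1" and 2: "c * q + d * r = 1"
    using assms coprime_poly_imp_bezout by meson
  \<comment> \<open>The product of the two Bezout identities, with all terms containing
    \<open>r\<close> collected, is a Bezout identity for \<open>p * q\<close> and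
    \<open>r\<close>.\<close>
  have "(a * c) * (p * q) + (a * p * d + b * c * q + b * d * r) * r = (a * p + b * r) * (c * q + d * r)"
    by (simp add: algebra_simps)
  then show ?thesis using 1 2 bezout_imp_coprime_poly by (metis mult_1)
qed

lemma coprime_prod_poly:
  fixes m :: "'i \<Rightarrow> 'a::field poly"
  shows "(\<And>i. i \<in> I \<Longrightarrow> coprime (m i) r) \<Longrightarrow> coprime (\<Prod>i\<in>I. m i) r"
  by (induction I rule: infinite_finite_induct) (auto intro: coprime_mult_poly)

text \<open>Turns coprimality into a condition on irreducible factors, which the sieve below can
  count. A common divisor is nonzero because \<open>q\<close> is, so a non-unit one has positive
  degree.\<close>

lemma not_coprime_poly_iff:
  fixes p q :: "'a::field poly"
  assumes "q \<noteq> 0"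
  shows "\<not> coprime p q \<longleftrightarrow> (\<exists>\<phi>\<in>irred_monic. \<phi> dvd p \<and> \<phi> dvd q)"
proof
  assume "\<not> coprime p q"
  then obtain d where d: "d dvd p" "d dvd q" "\<not> is_unit d" by (auto simp: coprime_def)
  then have "d \<noteq> 0" using assms by auto
  then have "degree d > 0" using d is_unit_iff_degree by auto
  then obtain \<phi> where "\<phi> \<in> irred_monic" "\<phi> dvd d" using exists_irred_monic_dvd by blast
  then show "\<exists>\<phi>\<in>irred_monic. \<phi> dvd p \<and> \<phi> dvd q"
    using d(1,2) by (intro bexI[of _ \<phi>]) (auto intro: dvd_trans)
next
  assume "\<exists>\<phi>\<in>irred_monic. \<phi> dvd p \<and> \<phi> dvd q"
  then obtain \<phi> where \<phi>: "\<phi> \<in> irred_monic" "\<phi> dvd p" "\<phi> dvd q" by blast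
  then have "\<not> is_unit \<phi>" using irred_monicD(1)[OF \<phi>(1)] by (simp add: irreducible_def)
  then show "\<not> coprime p q" using \<phi>(2,3) coprime_common_divisor by blast
qed

text \<open>The cofactor is a unit, hence a constant, and comparing leading coefficients makes it
  \<open>1\<close>.\<close>

lemma irred_monic_dvd_irred_monic:
  assumes "\<phi> \<in> irred_monic" "\<psi> \<in> irred_monic" "\<phi> dvd \<psi>"
  shows "\<phi> = \<psi>"
proof -
  obtain c where c: "\<psi> = \<phi> * c" using assms by (auto simp: dvd_def)
  with assms have "is_unit c" using irred_monicD(1) by (metis irreducibleD irreducible_not_unit)
  then obtain k where k: "c = [:k:]" by (auto simp: is_unit_poly_iff)
  then have "lead_coeff \<psi> = k * lead_coeff \<phi>" unfolding c k by (simp only: lead_coeff_mult) simp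
  then have "k = 1" using irred_monicD(2)[OF assms(1)] irred_monicD(2)[OF assms(2)] by simp
  then show ?thesis using c k by simp
qed

lemma coprime_irred_monic_powers:
  assumes "\<phi> \<in> irred_monic" "\<psi> \<in> irred_monic" "\<phi> \<noteq> \<psi>"
  shows "coprime (\<phi> ^ k) (\<psi> ^ l)"
proof (rule ccontr)
  assume "\<not> coprime (\<phi> ^ k) (\<psi> ^ l)"
  moreover have "\<psi> ^ l \<noteq> 0" using irred_monicD(3)[OF assms(2)] by simp
  ultimately obtain \<theta> where \<theta>: "\<theta> \<in> irred_monic" "\<theta> dvd \<phi> ^ k" "\<theta> dvd \<psi> ^ l"
    by (subst (asm) not_coprime_poly_iff) auto
  then have "\<theta> dvd \<phi>" "\<theta> dvd \<psi>" using irred_monicD(5)[OF \<theta>(1)] prime_elem_dvd_power by blast+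
  then show False using irred_monic_dvd_irred_monic \<theta>(1) assms by blast
qed

section \<open>Coprime moduli, Chinese remainders and factorization\<close>

lemma prod_dvd_poly:
  fixes m :: "'i \<Rightarrow> 'a::field poly"
  assumes "finite I" "\<And>i j. i \<in> I \<Longrightarrow> j \<in> I \<Longrightarrow> i \<noteq> j \<Longrightarrow> coprime (m i) (m j)"
    and "\<And>i. i \<in> I \<Longrightarrow> m i dvd p"
  shows "(\<Prod>i\<in>I. m i) dvd p"
  using assms
proof (induction I rule: finite_induct)
  case (insert j I)
  then have "coprime (\<Prod>i\<in>I. m i) (m j)" by (intro coprime_prod_poly) (metis insertCI)
  then obtain a b where ab: "a * (\<Prod>i\<in>I. m i) + b * m j = 1" using coprime_poly_imp_bezout by blast
  obtain u v where u: "p = (\<Prod>i\<in>I. m i) * u" and v: "p = m j * v"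
    using insert by (metis dvdE insertCI)
  \<comment> \<open>In each summand of the Bezout identity times \<open>p\<close>, the factor
    \<open>p\<close> is replaced by its expression as a multiple of the other modulus.\<close>
  have "p = (a * (\<Prod>i\<in>I. m i) + b * m j) * p" using ab by simp
  also have "\<dots> = (m j * (\<Prod>i\<in>I. m i)) * (a * v + b * u)"
  proof -
    have "(a * (\<Prod>i\<in>I. m i) + b * m j) * p = a * (\<Prod>i\<in>I. m i) * p + b * m j * p"
      by (rule distrib_right)
    also have "a * (\<Prod>i\<in>I. m i) * p = a * (\<Prod>i\<in>I. m i) * (m j * v)" using v by simp
    also have "b * m j * p = b * m j * ((\<Prod>i\<in>I. m i) * u)" using u by simp
    finally show ?thesis by (simp add: algebra_simps)
  qed
  finally show ?case using insert.hyps by (metis dvd_triv_left prod.insert)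
qed simp

lemma chinese_remainder_poly:
  fixes m g :: "'i \<Rightarrow> 'a::field poly"
  assumes "finite I" "\<And>i j. i \<in> I \<Longrightarrow> j \<in> I \<Longrightarrow> i \<noteq> j \<Longrightarrow> coprime (m i) (m j)"
  shows "\<exists>p. \<forall>i\<in>I. p mod m i = g i mod m i"
  using assms
proof (induction I rule: finite_induct)
  case (insert j I)
  then obtain p where p: "\<forall>i\<in>I. p mod m i = g i mod m i" by auto
  let ?M = "\<Prod>i\<in>I. m i"
  have "coprime ?M (m j)" using insert by (intro coprime_prod_poly) (metis insertCI)
  then obtain a b where ab: "a * ?M + b * m j = 1" using coprime_poly_imp_bezout by blast
  \<comment> \<open>\<open>a * ?M\<close> is \<open>0\<close> modulo the old moduli and
    \<open>1\<close> modulo \<open>m j\<close>, so the added term changes only the residue at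
    \<open>j\<close>, turning it into that of \<open>g j\<close>.\<close>
  define r where "r = p + a * ?M * (g j - p)"
  have "r mod m i = g i mod m i" if "i \<in> I" for i
  proof -
    have "m i dvd ?M" using that insert.hyps by (simp add: dvd_prodI)
    then have "m i dvd r - p" unfolding r_def by simp
    then show ?thesis using p that by (metis mod_eq_dvd_iff)
  qed
  moreover have "r mod m j = g j mod m j"
  proof -
    have "g j - r = (a * ?M + b * m j) * (g j - p) - a * ?M * (g j - p)"
      unfolding ab r_def by (simp add: algebra_simps)
    then have "g j - r = m j * (b * (g j - p))" by (simp add: algebra_simps)
    then show ?thesis by (metis dvd_triv_left mod_eq_dvd_iff)
  qed
  ultimately show ?case by blast
qed simp

lemma monic_factorization:
  fixes f :: "'a::field poly"
  assumes "lead_coeff f = 1"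
  shows "\<exists>P k. finite P \<and> P \<subseteq> irred_monic \<and> (\<forall>\<phi>\<in>P. k \<phi> > 0) \<and> f = (\<Prod>\<phi>\<in>P. \<phi> ^ k \<phi>)"
  using assms
proof (induction "degree f" arbitrary: f rule: less_induct)
  case less
  show ?case
  proof (cases "degree f = 0")
    case True
    then have "f = 1" using less.prems by (metis degree_0_id one_pCons of_nat_1 of_nat_poly)
    then show ?thesis by (intro exI[of _ "{}"]) auto
  next
    case False
    then obtain \<phi> where \<phi>: "\<phi> \<in> irred_monic" "\<phi> dvd f" using exists_irred_monic_dvd by auto
    then obtain g where g: "f = \<phi> * g" by (auto simp: dvd_def)
    have lg: "lead_coeff g = 1" using less.prems irred_monicD(2)[OF \<phi>(1)] g by (simp add: lead_coeff_mult)
    then have "degree g < degree f"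
      using g irred_monicD(3,4)[OF \<phi>(1)] by (subst g, subst degree_mult_eq) auto
    from less.hyps[OF this lg] obtain P k where P: "finite P" "P \<subseteq> irred_monic" "\<forall>\<psi>\<in>P. k \<psi> > 0"
      and gP: "g = (\<Prod>\<psi>\<in>P. \<psi> ^ k \<psi>)" by blast
    \<comment> \<open>A new irreducible gets exponent \<open>1\<close> outright, since
      \<open>k\<close> is unspecified outside \<open>P\<close>.\<close>
    define k' where "k' = (\<lambda>\<psi>. if \<psi> = \<phi> then (if \<phi> \<in> P then Suc (k \<phi>) else 1) else k \<psi>)"
    have "(\<Prod>\<psi>\<in>insert \<phi> P. \<psi> ^ k' \<psi>) = \<phi> ^ k' \<phi> * (\<Prod>\<psi>\<in>P-{\<phi>}. \<psi> ^ k' \<psi>)"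
      using P(1) by (simp add: prod.insert_remove)
    also have "(\<Prod>\<psi>\<in>P-{\<phi>}. \<psi> ^ k' \<psi>) = (\<Prod>\<psi>\<in>P-{\<phi>}. \<psi> ^ k \<psi>)"
      by (intro prod.cong) (auto simp: k'_def)
    also have "\<phi> ^ k' \<phi> * \<dots> = f"
      unfolding g gP using P(1) by (auto simp: k'_def prod.remove)
    finally show ?thesis
      using P \<phi>(1) by (intro exI[of _ "insert \<phi> P"] exI[of _ k']) (auto simp: k'_def)
  qed
qed

section \<open>Counting polynomials over a finite field\<close>

text \<open>Stated with coefficients because \<open>degree 0 = 0\<close>: \<open>poly_lt 0\<close> must be \<open>{0}\<close>.\<close>

definition poly_lt :: "nat \<Rightarrow> 'a::zero poly set" where
  "poly_lt n = {p. \<forall>i\<ge>n. coeff p i = 0}"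

definition monics :: "nat \<Rightarrow> 'a::zero_neq_one poly set" where
  "monics n = {f. degree f = n \<and> lead_coeff f = 1}"

definition irred_le :: "nat \<Rightarrow> 'a::field poly set" where
  "irred_le n = {\<phi>\<in>irred_monic. degree \<phi> \<le> n}"

definition irred_factors :: "'a::field poly \<Rightarrow> 'a poly set" where
  "irred_factors f = {\<phi>\<in>irred_monic. \<phi> dvd f}"

lemma poly_lt_iff: "p \<in> poly_lt n \<longleftrightarrow> p = 0 \<or> degree p < n"
proof
  assume "p \<in> poly_lt n"
  then have "coeff p (degree p) = 0" if "n \<le> degree p" using that by (simp add: poly_lt_def)
  then show "p = 0 \<or> degree p < n" by (cases "n \<le> degree p") auto
qed (auto simp: poly_lt_def coeff_eq_0)

lemma poly_lt_diff: "p \<in> poly_lt n \<Longrightarrow> r \<in> poly_lt n \<Longrightarrow> p - r \<in> poly_lt n" for p r :: "'a::ab_group_add poly"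
  by (simp add: poly_lt_def)

lemma dvd_poly_lt_imp_0:
  fixes f p :: "'a::field poly"
  assumes "f dvd p" "p \<in> poly_lt n" "degree f = n"
  shows "p = 0"
  using assms dvd_imp_degree_le[of f p] by (cases "p = 0") (auto simp: poly_lt_iff)

lemma mod_in_poly_lt: "f \<noteq> 0 \<Longrightarrow> p mod f \<in> poly_lt (degree f)" for f p :: "'a::field poly"
  using degree_mod_less[of f p] by (auto simp: poly_lt_iff)

lemma mod_poly_lt: "p \<in> poly_lt (degree f) \<Longrightarrow> p mod f = p" for f p :: "'a::field poly"
  by (auto simp: poly_lt_iff mod_poly_less)

lemma poly_lt_Suc: "poly_lt (Suc n) = (\<lambda>(a, p). pCons a p) ` (UNIV \<times> poly_lt n)"
proof (intro equalityI subsetI)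
  fix p :: "'a poly" assume p: "p \<in> poly_lt (Suc n)"
  obtain a r where r: "p = pCons a r" by (rule pCons_cases)
  have "coeff r i = 0" if "n \<le> i" for i
    using p r that unfolding poly_lt_def by (auto dest: spec[of _ "Suc i"])
  then have "r \<in> poly_lt n" by (simp add: poly_lt_def)
  with r show "p \<in> (\<lambda>(a, p). pCons a p) ` (UNIV \<times> poly_lt n)" by auto
qed (auto simp: poly_lt_def coeff_pCons split: nat.splits)

lemma card_poly_lt: "finite (poly_lt n :: 'a::{zero,finite} poly set) \<and> card (poly_lt n :: 'a poly set) = CARD('a) ^ n"
proof (induction n)
  case 0
  have "poly_lt 0 = {0 :: 'a poly}" by (auto simp: poly_lt_def poly_eq_iff)
  then show ?case by simp
next
  case (Suc n)
  have "inj_on (\<lambda>(a :: 'a, p). pCons a p) (UNIV \<times> poly_lt n)" by (auto simp: inj_on_def)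
  with Suc show ?case unfolding poly_lt_Suc by (simp add: card_image card_cartesian_product)
qed

lemmas finite_poly_lt [simp] = card_poly_lt[THEN conjunct1]

lemma monicsD: "f \<in> monics n \<Longrightarrow> degree f = n \<and> lead_coeff f = 1 \<and> f \<noteq> 0"
  by (auto simp: monics_def)

lemma monics_eq: "monics n = (\<lambda>r. monom 1 n + r) ` (poly_lt n :: 'a::field poly set)"
proof (intro equalityI subsetI)
  fix f :: "'a poly" assume f: "f \<in> monics n"
  then have "f - monom 1 n \<in> poly_lt n"
    by (auto simp: poly_lt_def monics_def coeff_eq_0)
  then show "f \<in> (\<lambda>r. monom 1 n + r) ` poly_lt n" by (intro image_eqI[of _ _ "f - monom 1 n"]) auto
next
  fix f :: "'a poly" assume "f \<in> (\<lambda>r. monom 1 n + r) ` poly_lt n"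
  then obtain r where r: "f = monom 1 n + r" "r \<in> poly_lt n" by auto
  then have "coeff f n = 1" "\<forall>i>n. coeff f i = 0" by (auto simp: poly_lt_def)
  moreover from this have "degree f = n" by (metis degree_le le_antisym le_degree zero_neq_one)
  ultimately show "f \<in> monics n" by (simp add: monics_def)
qed

lemma card_monics:
  "finite (monics n :: 'a::{field,finite} poly set)" "card (monics n :: 'a poly set) = CARD('a) ^ n"
proof -
  show "finite (monics n :: 'a poly set)" by (simp add: monics_eq)
  show "card (monics n :: 'a poly set) = CARD('a) ^ n"
    unfolding monics_eq by (subst card_image) (auto simp: inj_on_def card_poly_lt)
qed

lemma finite_irred_le [simp]: "finite (irred_le n :: 'a::{field,finite} poly set)"
proof -
  have "(irred_le n :: 'a poly set) \<subseteq> poly_lt (Suc n)" by (auto simp: irred_le_def poly_lt_iff)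
  then show ?thesis using finite_poly_lt finite_subset by blast
qed

lemma irred_factors_subset: "f \<noteq> 0 \<Longrightarrow> irred_factors f \<subseteq> irred_le (degree f)"
  by (auto simp: irred_factors_def irred_le_def dvd_imp_degree_le)

lemma finite_irred_factors: "f \<noteq> 0 \<Longrightarrow> finite (irred_factors f)" for f :: "'a::{field,finite} poly"
  using irred_factors_subset finite_irred_le finite_subset by blast

text \<open>Dividing out one irreducible leaves the conditions at the others unchanged, as both
  sieves below require.\<close>

lemma irred_monic_dvd_mult_other:
  assumes "\<phi> \<in> irred_monic" "\<psi> \<in> irred_monic" "\<phi> \<noteq> \<psi>"
  shows "\<psi> dvd \<phi> * s \<longleftrightarrow> \<psi> dvd s"
  using irred_monicD(5)[OF assms(2)] irred_monic_dvd_irred_monic[OF assms(2,1)] assms(3)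
  by (auto simp: prime_elem_dvd_mult_iff)

lemma CARD_field_gt_1: "CARD('a::{field,finite}) > 1"
proof -
  have "card {0, 1 :: 'a} \<le> CARD('a)" by (intro card_mono) auto
  then show ?thesis by simp
qed

lemma irred_norm_gt_1:
  assumes "\<phi> \<in> (irred_monic :: 'a::{field,finite} poly set)"
  shows "real CARD('a) ^ degree \<phi> > 1"
  using irred_monicD(4)[OF assms] CARD_field_gt_1[where 'a='a] by (simp add: one_less_power)

section \<open>Sieving residues and monic polynomials by irreducible factors\<close>

lemma mult_in_poly_lt_iff:
  fixes \<phi> s :: "'a::field poly"
  assumes "\<phi> \<noteq> 0"
  shows "\<phi> * s \<in> poly_lt (degree \<phi> + n) \<longleftrightarrow> s \<in> poly_lt n"
  using assms by (cases "s = 0") (auto simp: poly_lt_iff degree_mult_eq)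

lemma mult_in_monics_iff:
  fixes \<phi> s :: "'a::field poly"
  assumes "lead_coeff \<phi> = 1"
  shows "\<phi> * s \<in> monics (degree \<phi> + n) \<longleftrightarrow> s \<in> monics n"
proof -
  have "\<phi> \<noteq> 0" using assms by auto
  then show ?thesis using assms by (cases "s = 0") (auto simp: monics_def degree_mult_eq coeff_mult_degree_sum)
qed

text \<open>Sieve one irreducible at a time: division by \<open>\<phi>\<close> maps the survivors
  divisible by \<open>\<phi>\<close> onto the survivors for the quotient \<open>g\<close> of
  \<open>f\<close> by \<open>\<phi>\<close>. Only divisibility of \<open>f\<close> by the members of
  \<open>P\<close> is assumed, so that the induction can pass to \<open>g\<close>.\<close>

lemma card_residues_avoiding:
  fixes f :: "'a::{field,finite} poly"
  assumes "finite P" "P \<subseteq> irred_monic" "\<forall>\<phi>\<in>P. \<phi> dvd f" "f \<noteq> 0"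
  shows "real (card {r\<in>poly_lt (degree f). \<forall>\<phi>\<in>P. \<not> \<phi> dvd r}) =
    real CARD('a) ^ degree f * (\<Prod>\<phi>\<in>P. 1 - 1 / real CARD('a) ^ degree \<phi>)"
  using assms
proof (induction P arbitrary: f rule: finite_induct)
  case empty
  then show ?case by (simp add: card_poly_lt)
next
  case (insert \<phi> P)
  have \<phi>: "\<phi> \<in> irred_monic" and P: "P \<subseteq> irred_monic" using insert by auto
  have "\<phi> \<noteq> 0" using irred_monicD(3)[OF \<phi>] .
  from insert obtain g where g: "f = \<phi> * g" by (auto simp: dvd_def)
  then have g0: "g \<noteq> 0" and deg: "degree f = degree \<phi> + degree g"
    using insert.prems(3) by (auto simp: degree_mult_eq)
  have other: "\<psi> dvd \<phi> * s \<longleftrightarrow> \<psi> dvd s" if "\<psi> \<in> P" for \<psi> s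
    using irred_monic_dvd_mult_other[OF \<phi>] that P insert.hyps(2) by blast
  define A where "A = {r\<in>poly_lt (degree f). \<forall>\<psi>\<in>P. \<not> \<psi> dvd r}"
  define B where "B = {s\<in>poly_lt (degree g). \<forall>\<psi>\<in>P. \<not> \<psi> dvd s}"
  have "{r\<in>A. \<phi> dvd r} = (\<lambda>s. \<phi> * s) ` B"
    unfolding A_def B_def deg using mult_in_poly_lt_iff[OF \<open>\<phi> \<noteq> 0\<close>] other
    by (auto elim!: dvdE[of \<phi>])
  moreover have "inj_on (\<lambda>s. \<phi> * s) B" using \<open>\<phi> \<noteq> 0\<close> by (auto simp: inj_on_def)
  ultimately have cB: "card {r\<in>A. \<phi> dvd r} = card B" by (simp add: card_image)
  have fA: "finite A" by (simp add: A_def)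
  have "{r\<in>poly_lt (degree f). \<forall>\<psi>\<in>insert \<phi> P. \<not> \<psi> dvd r} = A - {r\<in>A. \<phi> dvd r}"
    by (auto simp: A_def)
  then have "real (card {r\<in>poly_lt (degree f). \<forall>\<psi>\<in>insert \<phi> P. \<not> \<psi> dvd r}) = real (card A) - real (card B)"
    using fA cB by (simp add: card_Diff_subset of_nat_diff card_mono flip: cB)
  also have "real (card A) = real CARD('a) ^ degree f * (\<Prod>\<phi>\<in>P. 1 - 1 / real CARD('a) ^ degree \<phi>)"
    unfolding A_def using insert.prems by (intro insert.IH) auto
  also have "real (card B) = real CARD('a) ^ degree g * (\<Prod>\<phi>\<in>P. 1 - 1 / real CARD('a) ^ degree \<phi>)"
    unfolding B_def using insert.prems g0 other g by (intro insert.IH) auto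
  also have "real CARD('a) ^ degree f * (\<Prod>\<phi>\<in>P. 1 - 1 / real CARD('a) ^ degree \<phi>) -
      real CARD('a) ^ degree g * (\<Prod>\<phi>\<in>P. 1 - 1 / real CARD('a) ^ degree \<phi>) =
      real CARD('a) ^ degree f * (1 - 1 / real CARD('a) ^ degree \<phi>) * (\<Prod>\<phi>\<in>P. 1 - 1 / real CARD('a) ^ degree \<phi>)"
    by (simp add: deg power_add algebra_simps)
  finally show ?case using insert.hyps by (simp add: mult.assoc)
qed

text \<open>This number is the totient \<open>\<Phi>(f)\<close>; its product formula is the sieve
  over all irreducible factors of \<open>f\<close>.\<close>

lemma card_coprime_residues:
  fixes f :: "'a::{field,finite} poly"
  assumes "f \<noteq> 0"
  shows "real (card {r\<in>poly_lt (degree f). coprime r f}) =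
    real CARD('a) ^ degree f * (\<Prod>\<phi>\<in>irred_factors f. 1 - 1 / real CARD('a) ^ degree \<phi>)"
proof -
  have "{r\<in>poly_lt (degree f). coprime r f} = {r\<in>poly_lt (degree f). \<forall>\<phi>\<in>irred_factors f. \<not> \<phi> dvd r}"
    using not_coprime_poly_iff[OF assms] by (auto simp: irred_factors_def)
  moreover have "irred_factors f \<subseteq> irred_monic" "\<forall>\<phi>\<in>irred_factors f. \<phi> dvd f"
    by (simp_all add: irred_factors_def)
  ultimately show ?thesis
    using card_residues_avoiding[OF finite_irred_factors[OF assms]] assms by simp
qed

text \<open>A monic multiple of \<open>\<phi>\<close> is \<open>\<phi>\<close> times a monic
  polynomial of complementary degree. The \<open>if\<close> excludes the case in which
  \<open>k - degree \<phi>\<close> would be truncated.\<close>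

lemma card_monics_avoiding_insert:
  fixes \<phi> :: "'a::{field,finite} poly"
  assumes "\<phi> \<in> irred_monic" "P \<subseteq> irred_monic" "\<phi> \<notin> P"
  shows "real (card {f\<in>monics k. \<forall>\<psi>\<in>insert \<phi> P. \<not> \<psi> dvd f}) =
    real (card {f\<in>monics k. \<forall>\<psi>\<in>P. \<not> \<psi> dvd f})
    - (if degree \<phi> \<le> k then real (card {f\<in>monics (k - degree \<phi>). \<forall>\<psi>\<in>P. \<not> \<psi> dvd f}) else 0)"
proof -
  define A where "A = {f\<in>monics k. \<forall>\<psi>\<in>P. \<not> \<psi> dvd f}"
  have fA: "finite A" by (simp add: A_def card_monics)
  have other: "\<psi> dvd \<phi> * s \<longleftrightarrow> \<psi> dvd s" if "\<psi> \<in> P" for \<psi> s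
    using irred_monic_dvd_mult_other[OF assms(1)] that assms by blast
  have "card {f\<in>A. \<phi> dvd f} = (if degree \<phi> \<le> k then card {f\<in>monics (k - degree \<phi>). \<forall>\<psi>\<in>P. \<not> \<psi> dvd f} else 0)"
  proof (cases "degree \<phi> \<le> k")
    case True
    then obtain l where l: "k = degree \<phi> + l" using le_Suc_ex by blast
    have "{f\<in>A. \<phi> dvd f} = (\<lambda>s. \<phi> * s) ` {f\<in>monics l. \<forall>\<psi>\<in>P. \<not> \<psi> dvd f}"
      unfolding A_def l using mult_in_monics_iff[OF irred_monicD(2)[OF assms(1)]] other
      by (auto elim!: dvdE[of \<phi>])
    moreover have "inj (\<lambda>s. \<phi> * s)" using irred_monicD(3)[OF assms(1)] by (auto simp: inj_on_def)
    moreover from this have "inj_on (\<lambda>s. \<phi> * s) {f\<in>monics l. \<forall>\<psi>\<in>P. \<not> \<psi> dvd f}"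
      by (rule inj_on_subset) simp
    ultimately show ?thesis using l by (simp add: card_image)
  next
    case False
    then have "{f\<in>A. \<phi> dvd f} = {}"
      unfolding A_def by (auto dest!: monicsD dvd_imp_degree_le)
    then show ?thesis using False by (simp only: card.empty if_False)
  qed
  moreover have "{f\<in>monics k. \<forall>\<psi>\<in>insert \<phi> P. \<not> \<psi> dvd f} = A - {f\<in>A. \<phi> dvd f}"
    by (auto simp: A_def)
  moreover have "real (card (A - {f\<in>A. \<phi> dvd f})) = real (card A) - real (card {f\<in>A. \<phi> dvd f})"
    using fA by (simp add: card_Diff_subset of_nat_diff card_mono)
  ultimately show ?thesis by (simp add: A_def)
qed

text \<open>By the recurrence, one more irreducible multiplies the generating function by
  \<open>1 - x ^ degree \<phi>\<close>. Without conditions there are \<open>q ^ k\<close> monics of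
  degree \<open>k\<close>, which gives a geometric series.\<close>

lemma sums_monics_avoiding:
  fixes P :: "'a::{field,finite} poly set" and x :: real
  assumes "finite P" "P \<subseteq> irred_monic" "0 \<le> x" "real CARD('a) * x < 1"
  shows "(\<lambda>k. real (card {f\<in>monics k. \<forall>\<psi>\<in>P. \<not> \<psi> dvd f}) * x ^ k) sums
    ((\<Prod>\<phi>\<in>P. 1 - x ^ degree \<phi>) / (1 - real CARD('a) * x))"
  using assms(1,2)
proof (induction P rule: finite_induct)
  case empty
  have "(\<lambda>k. (real CARD('a) * x) ^ k) sums (1 / (1 - real CARD('a) * x))"
    using assms(3,4) by (intro geometric_sums) simp
  then show ?case by (simp add: card_monics power_mult_distrib)
next
  case (insert \<phi> P)
  let ?c = "\<lambda>k. real (card {f\<in>monics k. \<forall>\<psi>\<in>P. \<not> \<psi> dvd f})"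
  let ?s = "(\<Prod>\<phi>\<in>P. 1 - x ^ degree \<phi>) / (1 - real CARD('a) * x)"
  have IH: "(\<lambda>k. ?c k * x ^ k) sums ?s" using insert by auto
  let ?d = "degree \<phi>"
  let ?h = "\<lambda>k. if ?d \<le> k then ?c (k - ?d) * x ^ k else 0"
  have "(\<lambda>k. ?h (k + ?d)) sums (x ^ ?d * ?s)"
    using sums_mult[OF IH, of "x ^ ?d"] by (simp add: power_add mult_ac)
  \<comment> \<open>The first \<open>?d\<close> terms of \<open>?h\<close> vanish, so prepending
    them keeps the sum.\<close>
  then have "?h sums (x ^ ?d * ?s)"
    by (subst (asm) sums_iff_shift) simp
  from sums_diff[OF IH this]
  have "(\<lambda>k. ?c k * x ^ k - ?h k) sums (?s - x ^ ?d * ?s)" .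
  also have "(\<lambda>k. ?c k * x ^ k - ?h k) = (\<lambda>k. real (card {f\<in>monics k. \<forall>\<psi>\<in>insert \<phi> P. \<not> \<psi> dvd f}) * x ^ k)"
    using insert by (subst card_monics_avoiding_insert) (auto simp: fun_eq_iff algebra_simps)
  also have "?s - x ^ ?d * ?s = (\<Prod>\<phi>\<in>insert \<phi> P. 1 - x ^ degree \<phi>) / (1 - real CARD('a) * x)"
    using insert.hyps by (simp add: algebra_simps diff_divide_distrib)
  finally show ?case .
qed

text \<open>
  The generating function of the monic polynomials without irreducible factor of degree at most \<open>N\<close>
  is the partial product divided by \<open>1 - q x\<close>.  Its coefficients of index \<open>1\<close> to \<open>N\<close> vanish, so it
  tends to \<open>1\<close>.
\<close>

lemma euler_product:
  fixes x :: real
  assumes "0 \<le> x" "real CARD('a::{field,finite}) * x < 1"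
  shows "(\<lambda>N. \<Prod>\<phi>\<in>(irred_le N :: 'a poly set). 1 - x ^ degree \<phi>) \<longlonglongrightarrow> 1 - real CARD('a) * x"
proof -
  define y where "y = real CARD('a) * x"
  have y: "0 \<le> y" "y < 1" using assms by (auto simp: y_def)
  define F where "F = (\<lambda>N. (\<Prod>\<phi>\<in>(irred_le N :: 'a poly set). 1 - x ^ degree \<phi>) / (1 - y))"
  define c where "c = (\<lambda>N k. real (card {f\<in>(monics k :: 'a poly set). \<forall>\<psi>\<in>irred_le N. \<not> \<psi> dvd f}))"
  have F: "(\<lambda>k. c N k * x ^ k) sums F N" for N
    unfolding F_def c_def y_def using assms
    by (intro sums_monics_avoiding) (auto simp: irred_le_def finite_irred_le[unfolded irred_le_def])
  have mon0: "monics 0 = {1 :: 'a poly}"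
    by (auto simp: monics_def elim!: degree_eq_zeroE simp: one_pCons)
  have c0: "c N 0 = 1" for N
  proof -
    have "{f\<in>(monics 0 :: 'a poly set). \<forall>\<psi>\<in>irred_le N. \<not> \<psi> dvd f} = {1}"
      unfolding mon0 using irred_monicD(1) by (auto simp: irred_le_def irreducible_def)
    then show ?thesis by (simp add: c_def)
  qed
  have cz: "c N k = 0" if "0 < k" "k \<le> N" for N k
  proof -
    have "\<exists>\<psi>\<in>irred_le N. \<psi> dvd f" if f: "f \<in> monics k" for f :: "'a poly"
    proof -
      have "degree f > 0" "f \<noteq> 0" using monicsD[OF f] \<open>0 < k\<close> by auto
      then obtain \<psi> where \<psi>: "\<psi> \<in> irred_monic" "\<psi> dvd f" using exists_irred_monic_dvd by blast
      then have "degree \<psi> \<le> degree f" using \<open>f \<noteq> 0\<close> by (intro dvd_imp_degree_le)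
      then have "degree \<psi> \<le> N" using monicsD[OF f] \<open>k \<le> N\<close> by simp
      with \<psi> show ?thesis by (auto simp: irred_le_def)
    qed
    then have "{f\<in>(monics k :: 'a poly set). \<forall>\<psi>\<in>irred_le N. \<not> \<psi> dvd f} = {}" by auto
    then show ?thesis unfolding c_def by (simp only: card.empty of_nat_0)
  qed
  have cle: "c N k * x ^ k \<le> y ^ k" for N k
  proof -
    have "c N k \<le> real (card (monics k :: 'a poly set))"
      unfolding c_def by (intro of_nat_mono card_mono card_monics(1)) auto
    then have "c N k * x ^ k \<le> real CARD('a) ^ k * x ^ k"
      using assms by (intro mult_right_mono) (auto simp: card_monics)
    then show ?thesis by (simp add: y_def power_mult_distrib)
  qed
  \<comment> \<open>The constant term alone is \<open>1\<close>, and all terms are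
    nonnegative.\<close>
  have lo: "1 \<le> F N" for N
  proof -
    have "(\<lambda>k. if k = 0 then 1 else 0) sums (1::real)" using sums_single[of 0 "\<lambda>_. 1::real"] by simp
    from this F show ?thesis
      by (rule sums_le[rotated]) (use c0 assms in \<open>auto simp: c_def\<close>)
  qed
  \<comment> \<open>Beyond index \<open>N\<close> the coefficients are at most those for all monics,
    which leaves a geometric tail in \<open>y < 1\<close>.\<close>
  have hi: "F N \<le> 1 + y ^ Suc N / (1 - y)" for N
  proof -
    have "(\<lambda>k. y ^ Suc N * y ^ k) sums (y ^ Suc N * (1 / (1 - y)))"
      using y by (intro sums_mult geometric_sums) simp
    then have "(\<lambda>k. (if k + Suc N \<le> N then 0 else y ^ (k + Suc N))) sums (y ^ Suc N / (1 - y))"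
      by (simp add: power_add mult_ac)
    then have "(\<lambda>k. if k \<le> N then 0 else y ^ k) sums (y ^ Suc N / (1 - y))"
      by (subst (asm) sums_iff_shift) (simp add: sum.neutral)
    then have "(\<lambda>k. (if k = 0 then 1 else 0) + (if k \<le> N then 0 else y ^ k)) sums (1 + y ^ Suc N / (1 - y))"
      using sums_single[of 0 "\<lambda>_. 1::real"] by (intro sums_add) simp_all
    from F this show ?thesis
      by (rule sums_le[rotated]) (use c0 cz cle in auto)
  qed
  have "(\<lambda>N. 1 + y ^ Suc N / (1 - y)) \<longlonglongrightarrow> 1 + 0 / (1 - y)"
    using y by (intro tendsto_intros LIMSEQ_power_zero[THEN LIMSEQ_Suc]) auto
  then have "F \<longlonglongrightarrow> 1"
    by (intro tendsto_sandwich[of "\<lambda>_. 1" F _ "\<lambda>N. 1 + y ^ Suc N / (1 - y)"]) (auto intro!: always_eventually lo hi simp del: power_Suc)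
  then have "(\<lambda>N. F N * (1 - y)) \<longlonglongrightarrow> 1 * (1 - y)" by (intro tendsto_intros)
  then show ?thesis using y unfolding F_def by (simp add: y_def)
qed

section \<open>The sum of inverse totients\<close>

text \<open>The product equals \<open>E 6 N / (E 2 N * E 3 N)\<close> for the Euler products
  \<open>E s\<close> at \<open>x = 1 / Q ^ s\<close>, whose limits are known; the identity is
  checked factor by factor with \<open>y = Q ^ degree \<phi>\<close>.\<close>

lemma tendsto_truncated_product:
  defines "Q \<equiv> real CARD('a::{field,finite})"
  shows "(\<lambda>N. \<Prod>\<phi>\<in>(irred_le N :: 'a poly set). 1 + 1 / (Q ^ degree \<phi> * (Q ^ degree \<phi> - 1)))
    \<longlonglongrightarrow> (1 - 1 / Q ^ 5) / ((1 - 1 / Q) * (1 - 1 / Q ^ 2))"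
proof -
  have Q: "Q > 1" unfolding Q_def using CARD_field_gt_1[where 'a='a] by simp
  define E where "E = (\<lambda>s N. \<Prod>\<phi>\<in>(irred_le N :: 'a poly set). 1 - (1 / Q ^ s) ^ degree \<phi>)"
  have E: "E (Suc s) \<longlonglongrightarrow> 1 - 1 / Q ^ s" if "s > 0" for s
  proof -
    have "Q * (1 / Q ^ Suc s) = 1 / Q ^ s" using Q by simp
    moreover have "1 / Q ^ s < 1" using Q that by (simp add: one_less_power)
    ultimately show ?thesis
      using euler_product[of "1 / Q ^ Suc s", where 'a='a] Q unfolding E_def Q_def[symmetric] by simp
  qed
  have pos: "1 / Q ^ s < 1" if "s > 0" for s using Q that by (simp add: one_less_power)
  have "(\<lambda>N. E 6 N / (E 2 N * E 3 N)) \<longlonglongrightarrow> (1 - 1 / Q ^ 5) / ((1 - 1 / Q ^ 1) * (1 - 1 / Q ^ 2))"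
  proof (intro tendsto_divide tendsto_mult)
    show "E 6 \<longlonglongrightarrow> 1 - 1 / Q ^ 5" using E[of 5] by simp
    show "E 2 \<longlonglongrightarrow> 1 - 1 / Q ^ 1" using E[of 1] by (simp add: numeral_2_eq_2)
    show "E 3 \<longlonglongrightarrow> 1 - 1 / Q ^ 2" using E[of 2] by simp
    have "0 < (1 - 1 / Q ^ 1) * (1 - 1 / Q ^ 2)"
      by (intro mult_pos_pos) (simp_all only: diff_gt_0_iff_gt pos zero_less_one zero_less_numeral)
    then show "(1 - 1 / Q ^ 1) * (1 - 1 / Q ^ 2) \<noteq> 0" by (metis less_irrefl)
  qed
  moreover have "E 6 N / (E 2 N * E 3 N) =
      (\<Prod>\<phi>\<in>(irred_le N :: 'a poly set). 1 + 1 / (Q ^ degree \<phi> * (Q ^ degree \<phi> - 1)))" for N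
  proof -
    have "(1 - (1 / Q ^ 6) ^ degree \<phi>) / ((1 - (1 / Q ^ 2) ^ degree \<phi>) * (1 - (1 / Q ^ 3) ^ degree \<phi>))
        = 1 + 1 / (Q ^ degree \<phi> * (Q ^ degree \<phi> - 1))" if "\<phi> \<in> irred_le N" for \<phi> :: "'a poly"
    proof -
      define y where "y = Q ^ degree \<phi>"
      have y: "y > 1" unfolding y_def Q_def using that by (auto simp: irred_le_def irred_norm_gt_1)
      have e: "(1 / Q ^ s) ^ degree \<phi> = 1 / y ^ s" for s
        unfolding y_def by (simp add: power_divide power_mult[symmetric] mult.commute)
      have "y ^ s > 1" if "s > 0" for s using y that by (simp add: one_less_power)
      from this[of 2] this[of 3] have nz: "y ^ 2 - 1 \<noteq> 0" "y ^ 3 - 1 \<noteq> 0" "y - 1 \<noteq> 0" "y \<noteq> 0"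
        using y by linarith+
      have "(1 - 1 / y ^ 6) / ((1 - 1 / y ^ 2) * (1 - 1 / y ^ 3)) =
          ((y ^ 6 - 1) / y ^ 6) / (((y ^ 2 - 1) / y ^ 2) * ((y ^ 3 - 1) / y ^ 3))"
        using nz by (simp add: diff_divide_distrib)
      also have "\<dots> = (y ^ 6 - 1) / ((y ^ 2 - 1) * (y ^ 3 - 1)) / y"
        using nz by (simp add: divide_simps) (simp add: eval_nat_numeral)
      \<comment> \<open>The factor \<open>y ^ 2 - y + 1\<close> is written as
        \<open>y * (y - 1) + 1\<close> so that the last quotient splits into
        \<open>1 + 1 / (y * (y - 1))\<close>.\<close>
      also have "y ^ 6 - 1 = (y ^ 3 - 1) * ((y + 1) * (y * (y - 1) + 1))"
        by (simp add: algebra_simps eval_nat_numeral)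
      also have "y ^ 2 - 1 = (y + 1) * (y - 1)"
        by (simp add: algebra_simps eval_nat_numeral)
      also have "(y ^ 3 - 1) * ((y + 1) * (y * (y - 1) + 1)) / ((y + 1) * (y - 1) * (y ^ 3 - 1)) / y
          = (y * (y - 1) + 1) / ((y - 1) * y)"
        using nz y by (simp add: divide_simps)
      also have "\<dots> = 1 + 1 / (y * (y - 1))" using nz by (simp add: divide_simps)
      finally show ?thesis unfolding e y_def[symmetric] .
    qed
    then show ?thesis unfolding E_def prod.distrib[symmetric] prod_dividef[symmetric]
      by (intro prod.cong) auto
  qed
  ultimately show ?thesis by simp
qed

text \<open>The case of a divisor of too large a degree is the source of the bound on the total
  degree in \<open>sum_inverse_totient\<close>.\<close>

lemma card_monics_dvd:
  fixes d :: "'a::{field,finite} poly"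
  assumes "lead_coeff d = 1"
  shows "real (card {f\<in>monics n. d dvd f}) / real CARD('a) ^ n =
    (if degree d \<le> n then 1 / real CARD('a) ^ degree d else 0)"
proof (cases "degree d \<le> n")
  case True
  then obtain l where l: "n = degree d + l" using le_Suc_ex by blast
  have "d \<noteq> 0" using assms by auto
  have "{f\<in>monics n. d dvd f} = (\<lambda>s. d * s) ` monics l"
    unfolding l using mult_in_monics_iff[OF assms] by (auto elim!: dvdE[of d])
  moreover have "inj_on (\<lambda>s. d * s) (monics l)" using \<open>d \<noteq> 0\<close> by (auto simp: inj_on_def)
  ultimately show ?thesis using l by (simp add: card_image card_monics power_add)
next
  case False
  then have "{f\<in>monics n. d dvd f} = {}" by (auto dest!: monicsD dvd_imp_degree_le)
  then show ?thesis using False by (simp only: card.empty if_False)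
qed

lemma lead_coeff_prod_irred:
  assumes "S \<subseteq> irred_monic"
  shows "lead_coeff (\<Prod>\<phi>\<in>S. \<phi>) = 1" "degree (\<Prod>\<phi>\<in>S. \<phi>) = (\<Sum>\<phi>\<in>S. degree \<phi>)"
proof -
  show "lead_coeff (\<Prod>\<phi>\<in>S. \<phi>) = 1"
    using assms by (auto simp: lead_coeff_prod irred_monic_def intro!: prod.neutral)
  show "degree (\<Prod>\<phi>\<in>S. \<phi>) = (\<Sum>\<phi>\<in>S. degree \<phi>)"
    using assms irred_monicD(3) by (intro degree_prod_sum_eq) blast
qed

text \<open>Distinct monic irreducibles are coprime. Sets of irreducible factors thereby index the
  square-free monic divisors of \<open>f\<close>.\<close>

lemma prod_irred_dvd_iff:
  fixes f :: "'a::{field,finite} poly"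
  assumes "S \<subseteq> irred_le n" "f \<in> monics n"
  shows "(\<Prod>\<phi>\<in>S. \<phi>) dvd f \<longleftrightarrow> S \<subseteq> irred_factors f"
proof -
  have S: "finite S" "S \<subseteq> irred_monic"
    using assms finite_subset[OF _ finite_irred_le] by (auto simp: irred_le_def)
  show ?thesis
  proof
    assume "(\<Prod>\<phi>\<in>S. \<phi>) dvd f"
    then show "S \<subseteq> irred_factors f"
      using S dvd_prodI[OF S(1), of _ "\<lambda>\<phi>. \<phi>"] by (auto simp: irred_factors_def intro: dvd_trans)
  next
    assume A: "S \<subseteq> irred_factors f"
    show "(\<Prod>\<phi>\<in>S. \<phi>) dvd f"
    proof (rule prod_dvd_poly[OF S(1)])
      fix \<phi> \<psi> assume "\<phi> \<in> S" "\<psi> \<in> S" "\<phi> \<noteq> \<psi>"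
      then show "coprime \<phi> \<psi>" using coprime_irred_monic_powers[of \<phi> \<psi> 1 1] S by auto
    qed (use A in \<open>auto simp: irred_factors_def\<close>)
  qed
qed

lemma sum_inverse_totient:
  fixes n :: nat
  defines "Q \<equiv> real CARD('a::{field,finite})"
  shows "(\<Sum>f\<in>(monics n :: 'a poly set). 1 / real (card {r\<in>poly_lt n. coprime r f})) =
    (\<Sum>S | S \<subseteq> (irred_le n :: 'a poly set) \<and> (\<Sum>\<phi>\<in>S. degree \<phi>) \<le> n.
       \<Prod>\<phi>\<in>S. 1 / (Q ^ degree \<phi> * (Q ^ degree \<phi> - 1)))"
proof -
  define w where "w = (\<lambda>S::'a poly set. \<Prod>\<phi>\<in>S. 1 / (Q ^ degree \<phi> - 1))"
  have Q1: "Q ^ degree \<phi> > 1" if "\<phi> \<in> irred_monic" for \<phi> :: "'a poly"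
    using irred_norm_gt_1[OF that] by (simp add: Q_def)
  then have "Q > 0" by (simp add: Q_def)
  have "1 / real (card {r\<in>poly_lt n. coprime r f}) =
      (\<Sum>S | S \<subseteq> irred_le n \<and> (\<Prod>\<phi>\<in>S. \<phi>) dvd f. w S / Q ^ n)"
    if f: "f \<in> monics n" for f :: "'a poly"
  proof -
    have d: "degree f = n" "f \<noteq> 0" using monicsD[OF f] by auto
    note fin = finite_irred_factors[OF d(2)]
    have "1 / real (card {r\<in>poly_lt n. coprime r f}) =
        (\<Prod>\<phi>\<in>irred_factors f. 1 / (1 - 1 / Q ^ degree \<phi>)) / Q ^ n"
      using card_coprime_residues[OF d(2)] unfolding d Q_def[symmetric]
      by (simp add: prod_dividef)
    \<comment> \<open>Each factor takes the form \<open>1 + 1 / (y - 1)\<close>, so that the product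
      expands into a sum over subsets of the irreducible factors.\<close>
    also have "(\<Prod>\<phi>\<in>irred_factors f. 1 / (1 - 1 / Q ^ degree \<phi>)) =
        (\<Prod>\<phi>\<in>irred_factors f. 1 / (Q ^ degree \<phi> - 1) + 1)"
    proof (rule prod.cong)
      fix \<phi> assume "\<phi> \<in> irred_factors f"
      then have "Q ^ degree \<phi> > 1" using Q1 by (simp add: irred_factors_def)
      moreover have "1 / (1 - 1 / y) = 1 / (y - 1) + 1" if "y > 1" for y :: real
        using that by (simp add: field_simps)
      ultimately show "1 / (1 - 1 / Q ^ degree \<phi>) = 1 / (Q ^ degree \<phi> - 1) + 1" by blast
    qed simp
    also have "\<dots> = (\<Sum>S\<in>Pow (irred_factors f). w S)"
      by (subst prod_add[OF fin]) (simp add: w_def)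
    also have "Pow (irred_factors f) = {S. S \<subseteq> irred_le n \<and> (\<Prod>\<phi>\<in>S. \<phi>) dvd f}"
      using prod_irred_dvd_iff[OF _ f] irred_factors_subset[OF d(2)] d(1) by auto
    finally show ?thesis by (simp add: sum_divide_distrib)
  qed
  then have "(\<Sum>f\<in>(monics n :: 'a poly set). 1 / real (card {r\<in>poly_lt n. coprime r f})) =
      (\<Sum>f\<in>monics n. \<Sum>S | S \<subseteq> irred_le n \<and> (\<Prod>\<phi>\<in>S. \<phi>) dvd f. w S / Q ^ n)"
    by (intro sum.cong) auto
  \<comment> \<open>The divisibility condition moves into an \<open>if\<close>, so that both sums
    range over fixed sets and can be interchanged.\<close>
  also have "\<dots> = (\<Sum>f\<in>monics n. \<Sum>S\<in>Pow (irred_le n). if (\<Prod>\<phi>\<in>S. \<phi>) dvd f then w S / Q ^ n else 0)"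
    by (intro sum.cong sum.mono_neutral_cong_left) auto
  also have "\<dots> = (\<Sum>S\<in>Pow (irred_le n). \<Sum>f\<in>monics n. if (\<Prod>\<phi>\<in>S. \<phi>) dvd f then w S / Q ^ n else 0)"
    by (rule sum.swap)
  \<comment> \<open>The \<open>Q ^ n\<close> from the totient is also the number of monics of degree
    \<open>n\<close>, so the inner sum becomes a proportion.\<close>
  also have "\<dots> = (\<Sum>S\<in>Pow (irred_le n). w S * (real (card {f\<in>monics n. (\<Prod>\<phi>\<in>S. \<phi>) dvd f}) / Q ^ n))"
    by (intro sum.cong refl) (simp add: sum.If_cases card_monics Int_def)
  also have "\<dots> = (\<Sum>S\<in>Pow (irred_le n). if (\<Sum>\<phi>\<in>S. degree \<phi>) \<le> n then w S / Q ^ (\<Sum>\<phi>\<in>S. degree \<phi>) else 0)"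
  proof (intro sum.cong refl)
    fix S :: "'a poly set" assume "S \<in> Pow (irred_le n)"
    then have "S \<subseteq> irred_monic" by (auto simp: irred_le_def)
    from card_monics_dvd[OF lead_coeff_prod_irred(1)[OF this], of n] lead_coeff_prod_irred(2)[OF this]
    show "w S * (real (card {f\<in>monics n. (\<Prod>\<phi>\<in>S. \<phi>) dvd f}) / Q ^ n) =
        (if (\<Sum>\<phi>\<in>S. degree \<phi>) \<le> n then w S / Q ^ (\<Sum>\<phi>\<in>S. degree \<phi>) else 0)"
      by (simp add: Q_def)
  qed
  also have "\<dots> = (\<Sum>S | S \<subseteq> irred_le n \<and> (\<Sum>\<phi>\<in>S. degree \<phi>) \<le> n. w S / Q ^ (\<Sum>\<phi>\<in>S. degree \<phi>))"
    by (intro sum.mono_neutral_cong_right) auto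
  also have "\<dots> = (\<Sum>S | S \<subseteq> (irred_le n :: 'a poly set) \<and> (\<Sum>\<phi>\<in>S. degree \<phi>) \<le> n.
       \<Prod>\<phi>\<in>S. 1 / (Q ^ degree \<phi> * (Q ^ degree \<phi> - 1)))"
    by (rule sum.cong[OF refl]) (simp add: w_def power_sum prod_dividef prod.distrib)
  finally show ?thesis .
qed

text \<open>A squeeze with nonnegative terms: the sum at \<open>n\<close> is at most the full
  product \<open>G n\<close>, and at least any fixed \<open>G N\<close> once \<open>n\<close> is
  large, because \<open>G N\<close> involves only finitely many sets \<open>S\<close>.\<close>

lemma tendsto_sum_inverse_totient:
  defines "Q \<equiv> real CARD('a::{field,finite})"
  shows "(\<lambda>n. \<Sum>f\<in>(monics n :: 'a poly set). 1 / real (card {r\<in>poly_lt n. coprime r f}))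
    \<longlonglongrightarrow> (1 - 1 / Q ^ 5) / ((1 - 1 / Q) * (1 - 1 / Q ^ 2))" (is "?a \<longlonglongrightarrow> ?L")
proof -
  define u where "u = (\<lambda>\<phi>::'a poly. 1 / (Q ^ degree \<phi> * (Q ^ degree \<phi> - 1)))"
  have u0: "u \<phi> \<ge> 0" if "\<phi> \<in> irred_monic" for \<phi>
    using irred_norm_gt_1[OF that] by (simp add: Q_def u_def)
  then have pu0: "(\<Prod>\<phi>\<in>S. u \<phi>) \<ge> 0" if "S \<subseteq> irred_le n" for S n
    using that by (intro prod_nonneg) (auto simp: irred_le_def)
  define G where "G = (\<lambda>N. \<Prod>\<phi>\<in>irred_le N. 1 + u \<phi>)"
  have G: "G N = (\<Sum>S\<in>Pow (irred_le N). \<Prod>\<phi>\<in>S. u \<phi>)" for N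
    using prod_add[OF finite_irred_le, of u "\<lambda>_. 1" N] by (simp add: G_def add.commute)
  have lim: "G \<longlonglongrightarrow> ?L"
    unfolding G_def u_def Q_def by (rule tendsto_truncated_product)
  have a: "?a n = (\<Sum>S | S \<subseteq> irred_le n \<and> (\<Sum>\<phi>\<in>S. degree \<phi>) \<le> n. \<Prod>\<phi>\<in>S. u \<phi>)" for n
    unfolding u_def Q_def by (rule sum_inverse_totient)
  have upper: "?a n \<le> G n" for n
    unfolding a G using pu0 by (intro sum_mono2) auto
  \<comment> \<open>The summand \<open>N\<close> makes \<open>irred_le N\<close> part of
    \<open>irred_le n\<close>; the other one bounds the total degree of every subset of
    \<open>irred_le N\<close>.\<close>
  have lower: "G N \<le> ?a n" if "N + (\<Sum>\<phi>\<in>irred_le N. degree (\<phi> :: 'a poly)) \<le> n" for N n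
    unfolding a G
  proof (intro sum_mono2)
    show "Pow (irred_le N) \<subseteq> {S. S \<subseteq> irred_le n \<and> (\<Sum>\<phi>\<in>S. degree (\<phi> :: 'a poly)) \<le> n}"
    proof
      fix S :: "'a poly set" assume S: "S \<in> Pow (irred_le N)"
      then have "(\<Sum>\<phi>\<in>S. degree \<phi>) \<le> (\<Sum>\<phi>\<in>irred_le N. degree (\<phi> :: 'a poly))"
        by (intro sum_mono2) auto
      with that S show "S \<in> {S. S \<subseteq> irred_le n \<and> (\<Sum>\<phi>\<in>S. degree \<phi>) \<le> n}"
        by (auto simp: irred_le_def)
    qed
  qed (use pu0 in auto)
  show ?thesis
  proof (rule order_tendstoI)
    fix x assume "x < ?L"
    then have "\<forall>\<^sub>F N in sequentially. x < G N" using lim order_tendstoD(1) by blast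
    then obtain N where "x < G N" using eventually_happens'[OF sequentially_bot] by blast
    then show "\<forall>\<^sub>F n in sequentially. x < ?a n"
      using lower[of N] by (intro eventually_sequentiallyI[of "N + (\<Sum>\<phi>\<in>irred_le N. degree (\<phi> :: 'a poly))"]) (rule less_le_trans)
  next
    fix x assume "?L < x"
    then have "\<forall>\<^sub>F n in sequentially. G n < x" using lim order_tendstoD(2) by blast
    then show "\<forall>\<^sub>F n in sequentially. ?a n < x"
      by eventually_elim (rule le_less_trans[OF upper])
  qed
qed

section \<open>Cyclic vectors\<close>

lemma index_mult_mat_vec_sum:
  assumes "A \<in> carrier_mat n m" "v \<in> carrier_vec m" "i < n"
  shows "(A *\<^sub>v v) $ i = (\<Sum>j<m. A $$ (i,j) * v $ j)"
  using assms by (auto simp: scalar_prod_def atLeast0LessThan intro!: sum.cong)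

text \<open>Padding with zero coefficients lets polynomials of different degrees share one summation
  range.\<close>

lemma poly_act_eq_sum_le:
  assumes "A \<in> carrier_mat n n" "degree p \<le> N"
  shows "poly_act A p v = vec n (\<lambda>i. \<Sum>k\<le>N. coeff p k * ((A ^\<^sub>m k) *\<^sub>v v) $ i)"
proof -
  have "(\<Sum>k\<le>degree p. coeff p k * ((A ^\<^sub>m k) *\<^sub>v v) $ i) = (\<Sum>k\<le>N. coeff p k * ((A ^\<^sub>m k) *\<^sub>v v) $ i)" for i
    using assms(2) by (intro sum.mono_neutral_left) (auto simp: coeff_eq_0)
  then show ?thesis using assms(1) by (simp add: poly_act_def)
qed

lemma poly_act_eq_sum_less:
  assumes "A \<in> carrier_mat n n" "p \<in> poly_lt N"
  shows "poly_act A p v = vec n (\<lambda>i. \<Sum>k<N. coeff p k * ((A ^\<^sub>m k) *\<^sub>v v) $ i)"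
proof -
  have "(\<Sum>k\<le>max N (degree p). coeff p k * ((A ^\<^sub>m k) *\<^sub>v v) $ i) = (\<Sum>k<N. coeff p k * ((A ^\<^sub>m k) *\<^sub>v v) $ i)" for i
    using assms(2) by (intro sum.mono_neutral_right) (auto simp: poly_lt_def)
  then show ?thesis using poly_act_eq_sum_le[OF assms(1), of p "max N (degree p)"] by simp
qed

lemma poly_act_carrier [simp]: "A \<in> carrier_mat n n \<Longrightarrow> poly_act A p v \<in> carrier_vec n"
  by (auto simp: poly_act_def)

text \<open>Matrix powers recurse by a factor on the right, while Horner's scheme needs the new
  factor on the left.\<close>

lemma pow_mat_Suc_mult_vec:
  fixes A :: "'a::field mat"
  assumes A: "A \<in> carrier_mat n n" and v: "v \<in> carrier_vec n"
  shows "(A ^\<^sub>m Suc k) *\<^sub>v v = A *\<^sub>v ((A ^\<^sub>m k) *\<^sub>v v)"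
  using v
proof (induction k arbitrary: v)
  case 0
  then show ?case using A by simp
next
  case (Suc k)
  have pow: "A ^\<^sub>m k \<in> carrier_mat n n" "A ^\<^sub>m Suc k \<in> carrier_mat n n" for k using A by auto
  have "(A ^\<^sub>m Suc (Suc k)) *\<^sub>v v = (A ^\<^sub>m Suc k) *\<^sub>v (A *\<^sub>v v)"
    using assoc_mult_mat_vec[OF pow(2) A Suc.prems] by simp
  also have "\<dots> = A *\<^sub>v ((A ^\<^sub>m k) *\<^sub>v (A *\<^sub>v v))" using Suc A by simp
  also have "(A ^\<^sub>m k) *\<^sub>v (A *\<^sub>v v) = (A ^\<^sub>m Suc k) *\<^sub>v v"
    using assoc_mult_mat_vec[OF pow(1) A Suc.prems] by simp
  finally show ?case .
qed

lemma poly_act_0 [simp]: "A \<in> carrier_mat n n \<Longrightarrow> poly_act A 0 v = 0\<^sub>v n"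
  by (auto simp: poly_act_def)

text \<open>Horner's scheme for \<open>p(A) v\<close>, the basis of the later inductions on
  polynomials.\<close>

lemma poly_act_pCons:
  fixes A :: "'a::field mat"
  assumes A: "A \<in> carrier_mat n n" and v: "v \<in> carrier_vec n"
  shows "poly_act A (pCons a p) v = a \<cdot>\<^sub>v v + A *\<^sub>v poly_act A p v"
proof (rule eq_vecI)
  show "dim_vec (poly_act A (pCons a p) v) = dim_vec (a \<cdot>\<^sub>v v + A *\<^sub>v poly_act A p v)"
    using A by (simp add: poly_act_def)
  fix i assume "i < dim_vec (a \<cdot>\<^sub>v v + A *\<^sub>v poly_act A p v)"
  then have i: "i < n" using A by simp
  let ?d = "degree p"
  let ?w = "\<lambda>k. (A ^\<^sub>m k) *\<^sub>v v"
  have w: "?w k \<in> carrier_vec n" for k using A v by (intro mult_mat_vec_carrier[of _ _ n]) auto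
  have "poly_act A (pCons a p) v $ i = (\<Sum>k\<le>Suc ?d. coeff (pCons a p) k * ?w k $ i)"
    using poly_act_eq_sum_le[OF A, of "pCons a p" "Suc ?d"] i by (simp add: degree_pCons_le)
  also have "\<dots> = a * v $ i + (\<Sum>k\<le>?d. coeff p k * ?w (Suc k) $ i)"
    using A v by (subst sum.atMost_Suc_shift) simp
  also have "(\<Sum>k\<le>?d. coeff p k * ?w (Suc k) $ i) = (\<Sum>k\<le>?d. \<Sum>j<n. A $$ (i,j) * (coeff p k * ?w k $ j))"
    unfolding pow_mat_Suc_mult_vec[OF A v] index_mult_mat_vec_sum[OF A w i]
    by (simp add: sum_distrib_left mult_ac)
  also have "\<dots> = (\<Sum>j<n. A $$ (i,j) * (\<Sum>k\<le>?d. coeff p k * ?w k $ j))"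
    by (subst sum.swap) (simp add: sum_distrib_left)
  also have "\<dots> = (A *\<^sub>v poly_act A p v) $ i"
    unfolding index_mult_mat_vec_sum[OF A poly_act_carrier[OF A] i]
    using A by (intro sum.cong) (auto simp: poly_act_def)
  finally show "poly_act A (pCons a p) v $ i = (a \<cdot>\<^sub>v v + A *\<^sub>v poly_act A p v) $ i"
    using A v i by simp
qed

lemma poly_act_1 [simp]: "A \<in> carrier_mat n n \<Longrightarrow> v \<in> carrier_vec n \<Longrightarrow> poly_act A 1 v = v"
  for A :: "'a::field mat"
  using poly_act_pCons[of A n v 1 0] by (auto simp: one_pCons mult_mat_vec_def)

lemma poly_act_add:
  fixes A :: "'a::field mat"
  assumes "A \<in> carrier_mat n n"
  shows "poly_act A (p + r) v = poly_act A p v + poly_act A r v"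
  unfolding poly_act_eq_sum_le[OF assms, of p "max (degree p) (degree r)", OF max.cobounded1]
    poly_act_eq_sum_le[OF assms, of r "max (degree p) (degree r)", OF max.cobounded2]
    poly_act_eq_sum_le[OF assms, of "p + r" "max (degree p) (degree r)", OF degree_add_le_max]
  by (auto simp: sum.distrib distrib_right)

lemma poly_act_smult:
  fixes A :: "'a::field mat"
  assumes "A \<in> carrier_mat n n"
  shows "poly_act A (smult c p) v = c \<cdot>\<^sub>v poly_act A p v"
  unfolding poly_act_eq_sum_le[OF assms, of p "degree p", OF order.refl]
    poly_act_eq_sum_le[OF assms, of "smult c p" "degree p", OF degree_smult_le]
  by (auto simp: sum_distrib_left mult_ac)

lemma poly_act_mult:
  fixes A :: "'a::field mat"
  assumes A: "A \<in> carrier_mat n n" and v: "v \<in> carrier_vec n"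
  shows "poly_act A (p * r) v = poly_act A p (poly_act A r v)"
proof (induction p)
  case 0
  then show ?case using A by simp
next
  case (pCons a p)
  have "0 \<cdot>\<^sub>v v + A *\<^sub>v w = A *\<^sub>v w" if "w \<in> carrier_vec n" for w
    using A v that mult_mat_vec_carrier[OF A that] by auto
  then show ?case
    using pCons A v by (simp add: poly_act_add poly_act_smult poly_act_pCons)
qed

lemma poly_act_diff_eq_0_iff:
  fixes A :: "'a::field mat"
  assumes A: "A \<in> carrier_mat n n"
  shows "poly_act A (p - r) v = 0\<^sub>v n \<longleftrightarrow> poly_act A p v = poly_act A r v"
proof -
  let ?d = "poly_act A (p - r) v" and ?r = "poly_act A r v"
  have p: "poly_act A p v = ?d + ?r" using poly_act_add[OF A, of "p - r" r v] by simp
  have carr: "?d \<in> carrier_vec n" "?r \<in> carrier_vec n" using A by simp_all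
  show ?thesis
  proof
    assume "poly_act A p v = ?r"
    then have eq: "?d + ?r = ?r" using p by simp
    have "?d $ i = 0" if "i < n" for i
      using arg_cong[OF eq, of "\<lambda>w. w $ i"] that carr by simp
    then show "?d = 0\<^sub>v n" using carr by (intro eq_vecI) auto
  qed (use p carr in simp)
qed

text \<open>The annihilators of \<open>v\<close> form an ideal. As polynomials in \<open>A\<close>
  commute, an annihilator of \<open>v\<close> also kills all that \<open>v\<close>
  generates.\<close>

lemma poly_act_eq_0_mult:
  fixes A :: "'a::field mat"
  assumes "A \<in> carrier_mat n n" "v \<in> carrier_vec n" "poly_act A p v = 0\<^sub>v n"
  shows "poly_act A (r * p) v = 0\<^sub>v n" "poly_act A p (poly_act A r v) = 0\<^sub>v n"
proof -
  have "0\<^sub>v n = poly_act A 0 v" using assms by simp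
  then have "poly_act A r (0\<^sub>v n) = 0\<^sub>v n" using poly_act_mult[OF assms(1,2), of r 0] assms(1) by simp
  then show 1: "poly_act A (r * p) v = 0\<^sub>v n" using poly_act_mult[OF assms(1,2), of r p] assms(3) by simp
  show "poly_act A p (poly_act A r v) = 0\<^sub>v n"
    using 1 poly_act_mult[OF assms(1,2), of p r] by (simp add: mult.commute)
qed

lemma card_carrier_vec:
  "finite (carrier_vec n :: 'a::{zero,finite} vec set) \<and> card (carrier_vec n :: 'a vec set) = CARD('a) ^ n"
proof -
  have bij: "bij_betw (\<lambda>v. \<lambda>i\<in>{..<n}. v $ i) (carrier_vec n :: 'a vec set) (PiE {..<n} (\<lambda>_. UNIV))"
    by (rule bij_betw_byWitness[where f' = "vec n"]) (auto simp: fun_eq_iff PiE_def extensional_def)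
  then show ?thesis
    using bij_betw_finite[OF bij] bij_betw_same_card[OF bij] card_PiE[of "{..<n}" "\<lambda>_. UNIV :: 'a set"]
      finite_PiE[of "{..<n}" "\<lambda>_. UNIV :: 'a set"] by simp
qed

lemmas finite_carrier_vec [simp] = card_carrier_vec[THEN conjunct1]

section \<open>Cyclic vectors and their annihilators\<close>

definition cyclic_vec :: "'a::field mat \<Rightarrow> 'a vec \<Rightarrow> bool" where
  "cyclic_vec A v \<longleftrightarrow> v \<in> carrier_vec (dim_row A) \<and> (\<forall>w\<in>carrier_vec (dim_row A). \<exists>p. w = poly_act A p v)"

text \<open>If a nonzero \<open>g\<close> kills \<open>v\<close>, then every vector is
  \<open>p v\<close> with \<open>p\<close> reduced modulo \<open>g\<close>, whence
  \<open>q ^ n \<le> q ^ degree g\<close>. So no nonzero member of \<open>poly_lt n\<close> kills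
  \<open>v\<close>; evaluation at \<open>v\<close> is injective there, and equal cardinalities make
  it bijective.\<close>

lemma cyclic_vec_minimal_poly:
  fixes A :: "'a::{field,finite} mat"
  assumes A: "A \<in> carrier_mat n n" and v: "cyclic_vec A v"
  shows "bij_betw (\<lambda>p. poly_act A p v) (poly_lt n) (carrier_vec n)"
    and "\<exists>f\<in>monics n. poly_act A f v = 0\<^sub>v n"
    and "f \<in> monics n \<Longrightarrow> poly_act A f v = 0\<^sub>v n \<Longrightarrow> poly_act A p v = 0\<^sub>v n \<longleftrightarrow> f dvd p"
proof -
  have vc: "v \<in> carrier_vec n" and surj: "\<And>w. w \<in> carrier_vec n \<Longrightarrow> \<exists>p. w = poly_act A p v"
    using v A by (auto simp: cyclic_vec_def)
  have deg: "n \<le> degree g" if g: "g \<noteq> 0" "poly_act A g v = 0\<^sub>v n" for g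
  proof -
    have "carrier_vec n \<subseteq> (\<lambda>p. poly_act A p v) ` poly_lt (degree g)"
    proof
      fix w :: "'a vec" assume "w \<in> carrier_vec n"
      then obtain p where p: "w = poly_act A p v" using surj by blast
      have "p - p mod g = (p div g) * g" by (simp add: minus_mod_eq_div_mult)
      then have "poly_act A (p - p mod g) v = 0\<^sub>v n" using poly_act_eq_0_mult(1)[OF A vc g(2)] by simp
      then have "w = poly_act A (p mod g) v" using p poly_act_diff_eq_0_iff[OF A] by blast
      then show "w \<in> (\<lambda>p. poly_act A p v) ` poly_lt (degree g)" using mod_in_poly_lt[OF g(1)] by blast
    qed
    then have "card (carrier_vec n :: 'a vec set) \<le> card ((\<lambda>p. poly_act A p v) ` poly_lt (degree g))"
      by (intro card_mono) simp_all
    also have "\<dots> \<le> card (poly_lt (degree g) :: 'a poly set)" by (rule card_image_le) simp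
    finally have "CARD('a) ^ n \<le> CARD('a) ^ degree g" by (simp add: card_poly_lt card_carrier_vec)
    then show ?thesis by (rule power_le_imp_le_exp[OF CARD_field_gt_1])
  qed
  have inj: "inj_on (\<lambda>p. poly_act A p v) (poly_lt n)"
  proof (rule inj_onI)
    fix p r assume pr: "p \<in> poly_lt n" "r \<in> poly_lt n" "poly_act A p v = poly_act A r v"
    then have "poly_act A (p - r) v = 0\<^sub>v n" using poly_act_diff_eq_0_iff[OF A] by blast
    moreover have "p - r \<in> poly_lt n" using pr poly_lt_diff by blast
    ultimately have "p - r = 0" using deg[of "p - r"] unfolding poly_lt_iff by linarith
    then show "p = r" by simp
  qed
  have "(\<lambda>p. poly_act A p v) ` poly_lt n = carrier_vec n"
    using A by (intro card_subset_eq) (auto simp: card_image[OF inj] card_poly_lt card_carrier_vec)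
  with inj show bij: "bij_betw (\<lambda>p. poly_act A p v) (poly_lt n) (carrier_vec n)" by (simp add: bij_betw_def)
  \<comment> \<open>As \<open>- z ^ n\<close> acts on \<open>v\<close> like some \<open>r\<close> in
    \<open>poly_lt n\<close>, the monic polynomial \<open>z ^ n + r\<close> kills
    \<open>v\<close>.\<close>
  have "poly_act A (- monom 1 n) v \<in> (\<lambda>p. poly_act A p v) ` poly_lt n"
    using bij A by (simp add: bij_betw_def)
  then obtain r where r: "r \<in> poly_lt n" "poly_act A (- monom 1 n) v = poly_act A r v" by auto
  then have "poly_act A (- monom 1 n - r) v = 0\<^sub>v n" using poly_act_diff_eq_0_iff[OF A] by blast
  from poly_act_eq_0_mult(1)[OF A vc this, of "-1"] have "poly_act A (monom 1 n + r) v = 0\<^sub>v n"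
    by (simp add: add.commute)
  moreover have "monom 1 n + r \<in> monics n" using r by (auto simp: monics_eq)
  ultimately show "\<exists>f\<in>monics n. poly_act A f v = 0\<^sub>v n" by blast
  assume f: "f \<in> monics n" "poly_act A f v = 0\<^sub>v n"
  have "f \<noteq> 0" "degree f = n" using monicsD[OF f(1)] by auto
  show "poly_act A p v = 0\<^sub>v n \<longleftrightarrow> f dvd p"
  proof
    assume p: "poly_act A p v = 0\<^sub>v n"
    have "p mod f = p - (p div f) * f" by (simp add: minus_div_mult_eq_mod)
    moreover have "poly_act A (p div f * f) v = 0\<^sub>v n" by (rule poly_act_eq_0_mult(1)[OF A vc f(2)])
    ultimately have "poly_act A (p mod f) v = 0\<^sub>v n"
      using poly_act_diff_eq_0_iff[OF A, of p "p div f * f" v] p by simp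
    then have "p mod f = 0"
      using deg[of "p mod f"] mod_in_poly_lt[OF \<open>f \<noteq> 0\<close>, of p] \<open>degree f = n\<close>
      unfolding poly_lt_iff by linarith
    then show "f dvd p" by (simp add: mod_eq_0_iff_dvd)
  next
    assume "f dvd p"
    then obtain k where "p = k * f" by (auto simp: dvd_def mult.commute)
    then show "poly_act A p v = 0\<^sub>v n" using poly_act_eq_0_mult(1)[OF A vc f(2)] by simp
  qed
qed

text \<open>Once \<open>v\<close> identifies the space with \<open>F[z]/(f)\<close>, a class
  generates it exactly when it is a unit; a Bezout identity serves both directions.\<close>

lemma cyclic_vec_poly_act_iff:
  fixes A :: "'a::{field,finite} mat"
  assumes A: "A \<in> carrier_mat n n" and v: "cyclic_vec A v" and f: "f \<in> monics n" "poly_act A f v = 0\<^sub>v n"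
  shows "cyclic_vec A (poly_act A r v) \<longleftrightarrow> coprime r f"
proof -
  have vc: "v \<in> carrier_vec n" and surj: "\<And>w. w \<in> carrier_vec n \<Longrightarrow> \<exists>p. w = poly_act A p v"
    using v A by (auto simp: cyclic_vec_def)
  have kernel: "poly_act A p v = poly_act A p' v \<longleftrightarrow> f dvd p - p'" for p p'
    using cyclic_vec_minimal_poly(3)[OF A v f, of "p - p'"] poly_act_diff_eq_0_iff[OF A] by blast
  show ?thesis
  proof
    assume "cyclic_vec A (poly_act A r v)"
    then obtain a where "v = poly_act A a (poly_act A r v)" using vc A by (auto simp: cyclic_vec_def)
    then have "poly_act A (a * r) v = poly_act A 1 v" using poly_act_mult[OF A vc] A vc by simp
    then obtain b where "a * r - 1 = f * b" using kernel by (auto simp: dvd_def)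
    then have "a * r + (- b) * f = 1" by (simp add: algebra_simps)
    then show "coprime r f" by (rule bezout_imp_coprime_poly)
  next
    assume "coprime r f"
    then obtain a b where ab: "a * r + b * f = 1" using coprime_poly_imp_bezout by blast
    have "a * r - 1 = f * (- b)" using ab by (simp add: algebra_simps)
    then have "f dvd a * r - 1" by simp
    then have "poly_act A (a * r) v = poly_act A 1 v" using kernel by blast
    then have a: "poly_act A a (poly_act A r v) = v" using poly_act_mult[OF A vc] A vc by simp
    have "\<exists>p. w = poly_act A p (poly_act A r v)" if w: "w \<in> carrier_vec n" for w
    proof -
      obtain p where "w = poly_act A p v" using surj[OF w] by blast
      then have "w = poly_act A (p * a) (poly_act A r v)"
        using poly_act_mult[OF A poly_act_carrier[OF A], of p a] a by simp
      then show ?thesis by blast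
    qed
    then show "cyclic_vec A (poly_act A r v)" using A by (auto simp: cyclic_vec_def)
  qed
qed

text \<open>Evaluation at one cyclic vector matches the units modulo \<open>f\<close> with the
  cyclic vectors, so \<open>A\<close> accounts for \<open>\<Phi>(f)\<close> of the cyclic pairs
  counted later.\<close>

lemma card_cyclic_vecs:
  fixes A :: "'a::{field,finite} mat"
  assumes A: "A \<in> carrier_mat n n" and v: "cyclic_vec A v" and f: "f \<in> monics n" "poly_act A f v = 0\<^sub>v n"
  shows "card {w. cyclic_vec A w \<and> poly_act A f w = 0\<^sub>v n} = card {r\<in>poly_lt n. coprime r f}"
proof -
  let ?h = "\<lambda>p. poly_act A p v"
  have vc: "v \<in> carrier_vec n" using v A by (auto simp: cyclic_vec_def)
  note bij = cyclic_vec_minimal_poly(1)[OF A v]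
  have "{w. cyclic_vec A w \<and> poly_act A f w = 0\<^sub>v n} = ?h ` {r\<in>poly_lt n. coprime r f}"
  proof (intro equalityI subsetI)
    fix w assume w: "w \<in> {w. cyclic_vec A w \<and> poly_act A f w = 0\<^sub>v n}"
    then have "w \<in> carrier_vec n" using A by (auto simp: cyclic_vec_def)
    then obtain r where "r \<in> poly_lt n" "w = ?h r" using bij by (auto simp: bij_betw_def)
    with w show "w \<in> ?h ` {r\<in>poly_lt n. coprime r f}" using cyclic_vec_poly_act_iff[OF A v f] by auto
  next
    fix w assume "w \<in> ?h ` {r\<in>poly_lt n. coprime r f}"
    then show "w \<in> {w. cyclic_vec A w \<and> poly_act A f w = 0\<^sub>v n}"
      using cyclic_vec_poly_act_iff[OF A v f] poly_act_eq_0_mult(2)[OF A vc f(2)] by auto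
  qed
  moreover have "inj_on ?h {r\<in>poly_lt n. coprime r f}"
    using bij unfolding bij_betw_def by (auto intro: inj_on_subset)
  ultimately show ?thesis by (simp add: card_image)
qed

section \<open>Regular matrices are the cyclic ones\<close>

text \<open>With at most one part per irreducible the moduli are pairwise coprime. By Chinese
  remainders the element that is \<open>1\<close> in every coordinate generates the direct sum, and
  its preimage under \<open>h\<close> is cyclic.\<close>

lemma regular_imp_cyclic_vec:
  fixes A :: "'a::{field,finite} mat"
  assumes A: "A \<in> carrier_mat n n" and reg: "regular_mat A"
  shows "\<exists>v. cyclic_vec A v"
proof -
  obtain lam h where part: "\<forall>\<phi>\<in>irred_monic. is_partition (lam \<phi>)"
    and len: "\<forall>\<phi>\<in>irred_monic. length (lam \<phi>) \<le> 1"
    and bij: "bij_betw h (carrier_vec n) (primary_sum lam)"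
    and smult: "\<And>p v. v \<in> carrier_vec n \<Longrightarrow> h (poly_act A p v) = primary_smult lam p (h v)"
    using reg A unfolding regular_mat_def canonical_partitions_def by auto
  let ?I = "primary_index lam" and ?m = "primary_modulus lam"
  have m: "?m i = fst i ^ (lam (fst i) ! 0)" "fst i \<in> irred_monic" "snd i = 0" "lam (fst i) ! 0 > 0"
    if i: "i \<in> ?I" for i
  proof -
    obtain \<phi> j where ij: "i = (\<phi>, j)" by force
    with i have \<phi>: "\<phi> \<in> irred_monic" "j < length (lam \<phi>)" by (auto simp: primary_index_def)
    with len have j: "j = 0" by fastforce
    with \<phi> have "lam \<phi> ! 0 \<in> set (lam \<phi>)" by simp
    with part \<phi> have "lam \<phi> ! 0 > 0" by (auto simp: is_partition_def)
    with ij \<phi> j show "?m i = fst i ^ (lam (fst i) ! 0)" "fst i \<in> irred_monic" "snd i = 0" "lam (fst i) ! 0 > 0"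
      by (auto simp: primary_modulus_def)
  qed
  \<comment> \<open>Parts of a partition are positive, so the moduli are nonconstant and
    \<open>1\<close> is a reduced representative.\<close>
  have one_mod: "1 mod ?m i = 1" if "i \<in> ?I" for i
  proof -
    have "degree (?m i) > 0"
      using m[OF that] irred_monicD(3,4)[OF m(2)[OF that]] by (simp add: degree_power_eq)
    then show ?thesis by (simp add: mod_poly_less)
  qed
  \<comment> \<open>The coordinate units embed the index set into the finite set
    \<open>primary_sum lam\<close>. Its finiteness gives \<open>one\<close> finite support and
    allows Chinese remainders.\<close>
  define e :: "'a poly \<times> nat \<Rightarrow> 'a poly \<times> nat \<Rightarrow> 'a poly" where "e = (\<lambda>i i'. if i' = i then 1 else 0)"
  have "e ` ?I \<subseteq> primary_sum lam"
    using one_mod by (auto simp: e_def primary_sum_def)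
  moreover have "finite (primary_sum lam)" using bij bij_betw_finite finite_carrier_vec by blast
  ultimately have "finite (e ` ?I)" by (rule finite_subset)
  moreover have "inj_on e ?I" by (rule inj_onI) (metis e_def zero_neq_one)
  ultimately have fin: "finite ?I" using finite_imageD by blast
  define one where "one = (\<lambda>i. if i \<in> ?I then 1 else 0 :: 'a poly)"
  have "one \<in> primary_sum lam"
    using one_mod fin by (auto simp: one_def primary_sum_def)
  then have "one \<in> h ` carrier_vec n" using bij by (simp add: bij_betw_def)
  then obtain v where v: "v \<in> carrier_vec n" "h v = one" by force
  have "\<exists>p. w = poly_act A p v" if w: "w \<in> carrier_vec n" for w
  proof -
    have hw: "h w \<in> primary_sum lam" using bij w by (auto simp: bij_betw_def)
    have "coprime (?m i) (?m j)" if "i \<in> ?I" "j \<in> ?I" "i \<noteq> j" for i j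
      using m[OF that(1)] m[OF that(2)] that(3) by (auto simp: prod_eq_iff intro!: coprime_irred_monic_powers)
    then obtain p where p: "\<forall>i\<in>?I. p mod ?m i = h w i mod ?m i"
      using chinese_remainder_poly[OF fin, of ?m "h w"] by blast
    have "h (poly_act A p v) = h w"
      unfolding smult[OF v(1)] v(2) using p hw by (auto simp: primary_smult_def one_def primary_sum_def)
    then have "poly_act A p v = w" using bij w A unfolding bij_betw_def inj_on_def by simp
    then show ?thesis by blast
  qed
  then show ?thesis using v A by (auto simp: cyclic_vec_def)
qed

text \<open>The vector \<open>v\<close> identifies the space with \<open>F[z]/(f)\<close>, which
  splits by Chinese remainders over the prime powers in \<open>f\<close>: one part for each
  irreducible factor.\<close>

lemma cyclic_vec_imp_regular:
  fixes A :: "'a::{field,finite} mat"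
  assumes A: "A \<in> carrier_mat n n" and v: "cyclic_vec A v"
  shows "regular_mat A"
proof -
  have vc: "v \<in> carrier_vec n" using v A by (auto simp: cyclic_vec_def)
  obtain f where f: "f \<in> monics n" "poly_act A f v = 0\<^sub>v n" using cyclic_vec_minimal_poly(2)[OF A v] by blast
  note bij = cyclic_vec_minimal_poly(1)[OF A v]
  have kernel: "poly_act A p v = poly_act A p' v \<longleftrightarrow> f dvd p - p'" for p p'
    using cyclic_vec_minimal_poly(3)[OF A v f, of "p - p'"] poly_act_diff_eq_0_iff[OF A] by blast
  obtain P k where P: "finite P" "P \<subseteq> irred_monic" "\<forall>\<phi>\<in>P. k \<phi> > 0" "f = (\<Prod>\<phi>\<in>P. \<phi> ^ k \<phi>)"
    using monic_factorization[of f] monicsD[OF f(1)] by auto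
  have cop: "coprime (\<phi> ^ k \<phi>) (\<psi> ^ k \<psi>)" if "\<phi> \<in> P" "\<psi> \<in> P" "\<phi> \<noteq> \<psi>" for \<phi> \<psi>
    using coprime_irred_monic_powers that P(2) by blast
  have f_dvd_iff: "f dvd p \<longleftrightarrow> (\<forall>\<phi>\<in>P. \<phi> ^ k \<phi> dvd p)" for p
  proof
    assume "f dvd p"
    then show "\<forall>\<phi>\<in>P. \<phi> ^ k \<phi> dvd p"
      using dvd_prodI[OF P(1), of _ "\<lambda>\<phi>. \<phi> ^ k \<phi>"] P(4) dvd_trans by blast
  next
    assume "\<forall>\<phi>\<in>P. \<phi> ^ k \<phi> dvd p"
    then show "f dvd p" unfolding P(4) using prod_dvd_poly[OF P(1), of "\<lambda>\<phi>. \<phi> ^ k \<phi>" p] cop by blast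
  qed
  define lam where "lam = (\<lambda>\<phi>. if \<phi> \<in> P then [k \<phi>] else [])"
  have I: "(\<phi>, j) \<in> primary_index lam \<longleftrightarrow> \<phi> \<in> P \<and> j = 0" for \<phi> j
    using P(2) by (auto simp: primary_index_def lam_def)
  have m: "primary_modulus lam (\<phi>, j) = \<phi> ^ k \<phi>" if "\<phi> \<in> P" "j = 0" for \<phi> j
    using that by (simp add: primary_modulus_def lam_def)
  \<comment> \<open>The Chinese remainder map on reduced representatives.\<close>
  define red where "red = (\<lambda>p (\<phi>, j). if \<phi> \<in> P \<and> j = (0::nat) then p mod \<phi> ^ k \<phi> else 0)"
  \<comment> \<open>A vector is read as \<open>p v\<close> with \<open>p\<close> in
    \<open>poly_lt n\<close> and then reduced. The next fact shows that any other \<open>p\<close>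
    representing the vector gives the same value.\<close>
  define h where "h = (\<lambda>w. red (inv_into (poly_lt n) (\<lambda>p. poly_act A p v) w))"
  have h: "h (poly_act A p v) = red p" for p
  proof -
    define r where "r = inv_into (poly_lt n) (\<lambda>p. poly_act A p v) (poly_act A p v)"
    have "poly_act A r v = poly_act A p v"
      unfolding r_def using bij A by (intro f_inv_into_f[of _ "\<lambda>p. poly_act A p v"]) (simp add: bij_betw_def)
    then have "f dvd r - p" using kernel by blast
    then have "\<forall>\<phi>\<in>P. r mod \<phi> ^ k \<phi> = p mod \<phi> ^ k \<phi>" using f_dvd_iff by (simp add: mod_eq_dvd_iff)
    then show ?thesis unfolding h_def r_def[symmetric] by (auto simp: red_def fun_eq_iff)
  qed
  have red_inj: "red p = red r \<longleftrightarrow> f dvd p - r" for p r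
  proof
    assume eq: "red p = red r"
    have "p mod \<phi> ^ k \<phi> = r mod \<phi> ^ k \<phi>" if "\<phi> \<in> P" for \<phi>
      using fun_cong[OF eq, of "(\<phi>, 0)"] that by (simp add: red_def)
    then show "f dvd p - r" using f_dvd_iff by (simp add: mod_eq_dvd_iff)
  next
    assume "f dvd p - r"
    then have "\<forall>\<phi>\<in>P. p mod \<phi> ^ k \<phi> = r mod \<phi> ^ k \<phi>" using f_dvd_iff by (simp add: mod_eq_dvd_iff)
    then show "red p = red r" by (auto simp: red_def fun_eq_iff)
  qed
  have red_in: "red p \<in> primary_sum lam" for p
  proof -
    have "finite (P \<times> {0::nat})" using P(1) by simp
    then have "finite {i. red p i \<noteq> 0}"
      by (rule finite_subset[rotated]) (auto simp: red_def split: if_splits)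
    then show ?thesis unfolding primary_sum_def using I m by (auto simp: red_def)
  qed
  have red_surj: "\<exists>p. g = red p" if g: "g \<in> primary_sum lam" for g
  proof -
    obtain p where p: "\<forall>\<phi>\<in>P. p mod \<phi> ^ k \<phi> = g (\<phi>, 0) mod \<phi> ^ k \<phi>"
      using chinese_remainder_poly[OF P(1), of "\<lambda>\<phi>. \<phi> ^ k \<phi>" "\<lambda>\<phi>. g (\<phi>, 0)"] cop by blast
    have "g (\<phi>, j) = red p (\<phi>, j)" for \<phi> j
    proof (cases "\<phi> \<in> P \<and> j = 0")
      case True
      then have "g (\<phi>, 0) mod primary_modulus lam (\<phi>, 0) = g (\<phi>, 0)" using g I by (auto simp: primary_sum_def)
      then show ?thesis using True p m[of \<phi> 0] by (simp add: red_def)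
    next
      case False
      then have "g (\<phi>, j) = 0" using g I by (auto simp: primary_sum_def)
      then show ?thesis using False by (auto simp: red_def)
    qed
    then show ?thesis by (intro exI[of _ p]) (auto simp: fun_eq_iff)
  qed
  have rep: "\<exists>p. w = poly_act A p v" if "w \<in> carrier_vec n" for w
    using v A that by (auto simp: cyclic_vec_def)
  have "bij_betw h (carrier_vec n) (primary_sum lam)"
    unfolding bij_betw_def
  proof
    show "inj_on h (carrier_vec n)"
    proof (rule inj_onI)
      fix w w' assume w: "w \<in> carrier_vec n" "w' \<in> carrier_vec n" "h w = h w'"
      obtain p p' where "w = poly_act A p v" "w' = poly_act A p' v" using rep w by blast
      then show "w = w'" using w(3) h red_inj kernel by simp
    qed
    show "h ` carrier_vec n = primary_sum lam"
    proof
      show "h ` carrier_vec n \<subseteq> primary_sum lam" using rep h red_in by fastforce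
      show "primary_sum lam \<subseteq> h ` carrier_vec n"
      proof
        fix g assume "g \<in> primary_sum lam"
        then obtain p where "g = h (poly_act A p v)" using red_surj h by metis
        then show "g \<in> h ` carrier_vec n" using A by auto
      qed
    qed
  qed
  moreover have "h (w + w') = primary_add (h w) (h w')"
    if w: "w \<in> carrier_vec n" "w' \<in> carrier_vec n" for w w'
  proof -
    obtain p p' where p: "w = poly_act A p v" "w' = poly_act A p' v" using rep w by blast
    then have "w + w' = poly_act A (p + p') v" using poly_act_add[OF A] by simp
    then have "h (w + w') = red (p + p')" using h by simp
    also have "\<dots> = primary_add (red p) (red p')"
      by (auto simp: red_def primary_add_def fun_eq_iff poly_mod_add_left)
    finally show ?thesis using p h by simp
  qed
  moreover have "h (poly_act A p w) = primary_smult lam p (h w)" if w: "w \<in> carrier_vec n" for p w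
  proof -
    obtain r where r: "w = poly_act A r v" using rep w by blast
    then have "poly_act A p w = poly_act A (p * r) v" using poly_act_mult[OF A vc] by simp
    then have "h (poly_act A p w) = red (p * r)" using h by simp
    also have "\<dots> = primary_smult lam p (red r)"
      by (auto simp: red_def primary_smult_def fun_eq_iff I m mod_mult_right_eq)
    finally show ?thesis using r h by simp
  qed
  moreover have "\<forall>\<phi>\<in>irred_monic. is_partition (lam \<phi>) \<and> length (lam \<phi>) \<le> 1"
    using P(3) by (auto simp: lam_def is_partition_def)
  ultimately show ?thesis
    using A unfolding regular_mat_def canonical_partitions_def by (intro exI[of _ lam]) auto
qed

section \<open>The order of the general linear group\<close>

text \<open>Matrices with linearly independent columns. Rectangular shapes let columns be added one
  at a time; \<open>k = n\<close> gives the general linear group.\<close>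

definition inj_mats :: "nat \<Rightarrow> nat \<Rightarrow> 'a::field mat set" where
  "inj_mats n k = {M\<in>carrier_mat n k. \<forall>c\<in>carrier_vec k. M *\<^sub>v c = 0\<^sub>v n \<longrightarrow> c = 0\<^sub>v k}"

lemma inj_on_mult_inj_mats:
  assumes "M \<in> inj_mats n k"
  shows "inj_on (\<lambda>c. M *\<^sub>v c) (carrier_vec k)"
proof (rule inj_onI)
  fix c d assume cd: "c \<in> carrier_vec k" "d \<in> carrier_vec k" "M *\<^sub>v c = M *\<^sub>v d"
  have M: "M \<in> carrier_mat n k" using assms by (simp add: inj_mats_def)
  have "M *\<^sub>v (c - d) = M *\<^sub>v c - M *\<^sub>v d" using mult_minus_distrib_mat_vec[OF M cd(1,2)] .
  also have "\<dots> = 0\<^sub>v n" using cd M by auto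
  finally have "c - d = 0\<^sub>v k" using assms cd by (auto simp: inj_mats_def)
  then have "(c - d) $ i = 0" if "i < k" for i using that by simp
  then show "c = d" using cd by (intro eq_vecI) auto
qed

lemma card_range_inj_mats:
  fixes M :: "'a::{field,finite} mat"
  assumes "M \<in> inj_mats n k"
  shows "card ((\<lambda>c. M *\<^sub>v c) ` carrier_vec k) = CARD('a) ^ k"
  using card_image[OF inj_on_mult_inj_mats[OF assms]] card_carrier_vec by metis

definition snoc_col :: "'a mat \<Rightarrow> 'a vec \<Rightarrow> 'a mat" where
  "snoc_col M v = mat (dim_row M) (Suc (dim_col M)) (\<lambda>(i,j). if j < dim_col M then M $$ (i,j) else v $ i)"

lemma snoc_col_mult_vec:
  fixes M :: "'a::field mat"
  assumes M: "M \<in> carrier_mat n k" and v: "v \<in> carrier_vec n" and c: "c \<in> carrier_vec (Suc k)"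
  shows "snoc_col M v *\<^sub>v c = M *\<^sub>v vec k (\<lambda>j. c $ j) + (c $ k) \<cdot>\<^sub>v v"
proof (rule eq_vecI)
  have S: "snoc_col M v \<in> carrier_mat n (Suc k)" using M by (simp add: snoc_col_def)
  show "dim_vec (snoc_col M v *\<^sub>v c) = dim_vec (M *\<^sub>v vec k (\<lambda>j. c $ j) + (c $ k) \<cdot>\<^sub>v v)"
    using S v by simp
  fix i assume "i < dim_vec (M *\<^sub>v vec k (\<lambda>j. c $ j) + (c $ k) \<cdot>\<^sub>v v)"
  then have i: "i < n" using v by simp
  have "(snoc_col M v *\<^sub>v c) $ i = (\<Sum>j<k. M $$ (i,j) * c $ j) + v $ i * c $ k"
    using index_mult_mat_vec_sum[OF S c i] M i by (simp add: snoc_col_def)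
  also have "(\<Sum>j<k. M $$ (i,j) * c $ j) = (M *\<^sub>v vec k (\<lambda>j. c $ j)) $ i"
    using index_mult_mat_vec_sum[OF M, of "vec k (\<lambda>j. c $ j)" i] i by simp
  finally show "(snoc_col M v *\<^sub>v c) $ i = (M *\<^sub>v vec k (\<lambda>j. c $ j) + (c $ k) \<cdot>\<^sub>v v) $ i"
    using v M i by (simp add: mult.commute)
qed

text \<open>A relation with nonzero last coefficient expresses the new column through the old ones;
  one with last coefficient zero is a relation among the old columns.\<close>

lemma snoc_col_in_inj_mats_iff:
  fixes M :: "'a::field mat"
  assumes M: "M \<in> carrier_mat n k" and v: "v \<in> carrier_vec n"
  shows "snoc_col M v \<in> inj_mats n (Suc k) \<longleftrightarrow> M \<in> inj_mats n k \<and> v \<notin> (\<lambda>c. M *\<^sub>v c) ` carrier_vec k"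
proof -
  have S: "snoc_col M v \<in> carrier_mat n (Suc k)" using M by (simp add: snoc_col_def)
  note mult = snoc_col_mult_vec[OF M v]
  \<comment> \<open>Extends coefficients of the old columns: \<open>a = 0\<close> tests the
    independence of \<open>M\<close>, and \<open>a = -1\<close> encodes the relation
    \<open>M c - v = 0\<close>.\<close>
  define ext where "ext = (\<lambda>c (a::'a). vec (Suc k) (\<lambda>j. if j < k then c $ j else a))"
  have ext: "ext c a \<in> carrier_vec (Suc k)" "vec k (\<lambda>j. ext c a $ j) = c" "ext c a $ k = a"
    if "c \<in> carrier_vec k" for c a using that by (auto simp: ext_def)
  show ?thesis
  proof (intro iffI conjI)
    assume inj: "snoc_col M v \<in> inj_mats n (Suc k)"
    have "c = 0\<^sub>v k" if c: "c \<in> carrier_vec k" "M *\<^sub>v c = 0\<^sub>v n" for c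
    proof -
      have "snoc_col M v *\<^sub>v ext c 0 = 0\<^sub>v n" using mult[OF ext(1)[OF c(1)]] ext[OF c(1)] c v by auto
      then have "ext c 0 = 0\<^sub>v (Suc k)" using inj ext(1)[OF c(1)] by (auto simp: inj_mats_def)
      then have "ext c 0 $ i = 0" if "i < k" for i using that by simp
      then show ?thesis using c by (intro eq_vecI) (auto simp: ext_def)
    qed
    then show "M \<in> inj_mats n k" using M by (auto simp: inj_mats_def)
    show "v \<notin> (\<lambda>c. M *\<^sub>v c) ` carrier_vec k"
    proof
      assume "v \<in> (\<lambda>c. M *\<^sub>v c) ` carrier_vec k"
      then obtain c where c: "c \<in> carrier_vec k" "v = M *\<^sub>v c" by auto
      have "snoc_col M v *\<^sub>v ext c (-1) = v + (-1) \<cdot>\<^sub>v v"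
        using mult[OF ext(1)[OF c(1)]] ext[OF c(1)] c by simp
      also have "\<dots> = 0\<^sub>v n" using v by auto
      finally have "ext c (-1) = 0\<^sub>v (Suc k)" using inj ext(1)[OF c(1)] by (auto simp: inj_mats_def)
      then have "ext c (-1) $ k = 0" by simp
      then show False using ext(3)[OF c(1)] by simp
    qed
  next
    assume A: "M \<in> inj_mats n k \<and> v \<notin> (\<lambda>c. M *\<^sub>v c) ` carrier_vec k"
    have "c = 0\<^sub>v (Suc k)" if c: "c \<in> carrier_vec (Suc k)" "snoc_col M v *\<^sub>v c = 0\<^sub>v n" for c
    proof -
      let ?c = "vec k (\<lambda>j. c $ j)"
      have eq: "M *\<^sub>v ?c + (c $ k) \<cdot>\<^sub>v v = 0\<^sub>v n" using mult[OF c(1)] c(2) by simp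
      have ck: "c $ k = 0"
      proof (rule ccontr)
        assume nz: "c $ k \<noteq> 0"
        \<comment> \<open>Scaling by this constant solves the relation for \<open>v\<close>.\<close>
        define a where "a = - inverse (c $ k)"
        have "v = M *\<^sub>v (a \<cdot>\<^sub>v ?c)"
        proof (rule eq_vecI)
          fix i assume "i < dim_vec (M *\<^sub>v (a \<cdot>\<^sub>v ?c))"
          then have i: "i < n" using M by simp
          have "(M *\<^sub>v ?c) $ i + c $ k * v $ i = 0"
            using arg_cong[OF eq, of "\<lambda>w. w $ i"] i M v by simp
          then have "v $ i = a * (M *\<^sub>v ?c) $ i" using nz by (simp add: a_def field_simps eq_neg_iff_add_eq_0)
          also have "\<dots> = (M *\<^sub>v (a \<cdot>\<^sub>v ?c)) $ i"
            using mult_mat_vec[OF M, of ?c a] M i by simp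
          finally show "v $ i = (M *\<^sub>v (a \<cdot>\<^sub>v ?c)) $ i" .
        qed (use M v in auto)
        then show False using A by auto
      qed
      have "M *\<^sub>v ?c = M *\<^sub>v ?c + (c $ k) \<cdot>\<^sub>v v" using ck M v by (intro eq_vecI) auto
      then have "M *\<^sub>v ?c = 0\<^sub>v n" using eq by simp
      then have z: "?c = 0\<^sub>v k" using A by (auto simp: inj_mats_def)
      have "c $ j = 0" if "j < Suc k" for j
        using arg_cong[OF z, of "\<lambda>w. w $ j"] ck that by (cases "j = k") auto
      then show ?thesis using c by (intro eq_vecI) auto
    qed
    then show "snoc_col M v \<in> inj_mats n (Suc k)" using S by (auto simp: inj_mats_def)
  qed
qed

lemma inj_mats_Suc:
  "inj_mats n (Suc k) = (\<lambda>(M, v). snoc_col M v) `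
     (SIGMA M : inj_mats n k. carrier_vec n - (\<lambda>c. M *\<^sub>v c) ` carrier_vec k)"
proof (intro equalityI subsetI)
  fix M' :: "'a mat" assume M': "M' \<in> inj_mats n (Suc k)"
  define M where "M = mat n k (\<lambda>ij. M' $$ ij)"
  define v where "v = vec n (\<lambda>i. M' $$ (i, k))"
  have "snoc_col M v = M'"
    using M' by (intro eq_matI) (auto simp: snoc_col_def M_def v_def inj_mats_def less_Suc_eq)
  moreover have "M \<in> carrier_mat n k" "v \<in> carrier_vec n" by (auto simp: M_def v_def)
  ultimately have "(M, v) \<in> (SIGMA M : inj_mats n k. carrier_vec n - (\<lambda>c. M *\<^sub>v c) ` carrier_vec k)"
    using M' snoc_col_in_inj_mats_iff[of M n k v] by auto
  then show "M' \<in> (\<lambda>(M, v). snoc_col M v) ` (SIGMA M : inj_mats n k. carrier_vec n - (\<lambda>c. M *\<^sub>v c) ` carrier_vec k)"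
    using \<open>snoc_col M v = M'\<close> by (intro image_eqI[of _ _ "(M, v)"]) auto
next
  fix M' :: "'a mat"
  assume "M' \<in> (\<lambda>(M, v). snoc_col M v) ` (SIGMA M : inj_mats n k. carrier_vec n - (\<lambda>c. M *\<^sub>v c) ` carrier_vec k)"
  then obtain M v where "M' = snoc_col M v" "M \<in> inj_mats n k" "v \<in> carrier_vec n"
    "v \<notin> (\<lambda>c. M *\<^sub>v c) ` carrier_vec k" by auto
  then show "M' \<in> inj_mats n (Suc k)" using snoc_col_in_inj_mats_iff[of M n k v] by (simp add: inj_mats_def)
qed

lemma inj_on_snoc_col: "inj_on (\<lambda>(M, v). snoc_col M v) (carrier_mat n k \<times> carrier_vec n)"
proof (rule inj_onI, clarify)
  fix M M' :: "'a mat" and v v' :: "'a vec"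
  assume c: "M \<in> carrier_mat n k" "M' \<in> carrier_mat n k" "v \<in> carrier_vec n" "v' \<in> carrier_vec n"
    and eq: "snoc_col M v = snoc_col M' v'"
  have e: "snoc_col M v $$ (i, j) = snoc_col M' v' $$ (i, j)" for i j using eq by simp
  have "M $$ (i, j) = M' $$ (i, j)" if "i < n" "j < k" for i j
    using e[of i j] that c by (simp add: snoc_col_def)
  moreover have "v $ i = v' $ i" if "i < n" for i
    using e[of i k] that c by (simp add: snoc_col_def)
  ultimately show "M = M' \<and> v = v'" using c by (auto intro!: eq_matI eq_vecI)
qed

text \<open>Columns are chosen in turn: the next one avoids the span of \<open>k\<close> independent
  columns, which has \<open>q ^ k\<close> elements.\<close>

lemma card_inj_mats:
  "finite (inj_mats n k :: 'a::{field,finite} mat set) \<and>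
   real (card (inj_mats n k :: 'a mat set)) = (\<Prod>i<k. real CARD('a) ^ n - real CARD('a) ^ i)"
proof (induction k)
  case 0
  have "inj_mats n 0 = {mat n 0 (\<lambda>_. 0 :: 'a)}"
    by (auto simp: inj_mats_def intro!: eq_matI)
  then show ?case by simp
next
  case (Suc k)
  let ?S = "SIGMA M : (inj_mats n k :: 'a mat set). carrier_vec n - (\<lambda>c. M *\<^sub>v c) ` carrier_vec k"
  have sub: "(\<lambda>c. M *\<^sub>v c) ` carrier_vec k \<subseteq> carrier_vec n" if "M \<in> inj_mats n k" for M :: "'a mat"
    using that by (auto simp: inj_mats_def)
  have fin: "finite ?S" using Suc by (intro finite_SigmaI) auto
  have "inj_on (\<lambda>(M, v). snoc_col M v) ?S"
    by (rule inj_on_subset[OF inj_on_snoc_col[of n k]]) (auto simp: inj_mats_def)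
  then have "real (card (inj_mats n (Suc k) :: 'a mat set)) = real (card ?S)"
    unfolding inj_mats_Suc by (simp add: card_image)
  also have "\<dots> = (\<Sum>M\<in>(inj_mats n k :: 'a mat set). real (card (carrier_vec n - (\<lambda>c. M *\<^sub>v c) ` carrier_vec k)))"
    using Suc by (subst card_SigmaI) auto
  also have "\<dots> = (\<Sum>M\<in>(inj_mats n k :: 'a mat set). real CARD('a) ^ n - real CARD('a) ^ k)"
  proof (intro sum.cong refl)
    fix M :: "'a mat" assume M: "M \<in> inj_mats n k"
    have "card ((\<lambda>c. M *\<^sub>v c) ` carrier_vec k) \<le> card (carrier_vec n :: 'a vec set)"
      using sub[OF M] by (intro card_mono) auto
    then show "real (card (carrier_vec n - (\<lambda>c. M *\<^sub>v c) ` carrier_vec k)) = real CARD('a) ^ n - real CARD('a) ^ k"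
      using sub[OF M] card_range_inj_mats[OF M]
      by (subst card_Diff_subset) (auto simp: card_carrier_vec of_nat_diff)
  qed
  finally show ?case using Suc fin unfolding inj_mats_Suc by (simp add: mult.commute)
qed

lemma inj_mats_square_inverse:
  assumes "P \<in> inj_mats n n"
  shows "\<exists>Q\<in>carrier_mat n n. Q * P = 1\<^sub>m n \<and> P * Q = 1\<^sub>m n"
proof -
  have P: "P \<in> carrier_mat n n" using assms by (simp add: inj_mats_def)
  have "det P \<noteq> 0" using det_0_iff_vec_prod_zero_field[OF P] assms by (auto simp: inj_mats_def)
  from det_non_zero_imp_unit[OF P this, where b = "()"] show ?thesis
    by (auto simp: Units_def ring_mat_def)
qed

section \<open>Counting regular matrices\<close>

definition krylov_mat :: "'a::field mat \<Rightarrow> 'a vec \<Rightarrow> 'a mat" where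
  "krylov_mat A v = mat (dim_row A) (dim_row A) (\<lambda>(i,j). ((A ^\<^sub>m j) *\<^sub>v v) $ i)"

text \<open>Through coefficient vectors, facts about the Krylov matrix become facts about evaluating
  members of \<open>poly_lt n\<close> at \<open>v\<close>.\<close>

lemma krylov_mat_mult_vec:
  fixes A :: "'a::field mat"
  assumes A: "A \<in> carrier_mat n n" and p: "p \<in> poly_lt n"
  shows "krylov_mat A v *\<^sub>v vec n (coeff p) = poly_act A p v"
proof (rule eq_vecI)
  have K: "krylov_mat A v \<in> carrier_mat n n" using A by (auto simp: krylov_mat_def)
  show "dim_vec (krylov_mat A v *\<^sub>v vec n (coeff p)) = dim_vec (poly_act A p v)"
    using K A by (simp add: poly_act_def)
  fix i assume "i < dim_vec (poly_act A p v)"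
  then have i: "i < n" using A by (simp add: poly_act_def)
  have "(krylov_mat A v *\<^sub>v vec n (coeff p)) $ i = (\<Sum>j<n. krylov_mat A v $$ (i,j) * coeff p j)"
    using index_mult_mat_vec_sum[OF K, of "vec n (coeff p)" i] i by simp
  also have "\<dots> = poly_act A p v $ i"
    unfolding poly_act_eq_sum_less[OF A p] using i A by (simp add: krylov_mat_def mult.commute)
  finally show "(krylov_mat A v *\<^sub>v vec n (coeff p)) $ i = poly_act A p v $ i" .
qed

lemma exists_poly_with_coeffs:
  fixes c :: "'a::field vec"
  assumes "c \<in> carrier_vec n"
  shows "\<exists>p\<in>poly_lt n. c = vec n (coeff p)"
proof -
  define p where "p = (\<Sum>j<n. monom (c $ j) j)"
  have co: "coeff p i = (if i < n then c $ i else 0)" for i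
    by (simp add: p_def coeff_sum)
  have "p \<in> poly_lt n" by (simp add: poly_lt_def co)
  moreover have "c = vec n (coeff p)" using assms co by (intro eq_vecI) auto
  ultimately show ?thesis by blast
qed

lemma krylov_mat_inj_mats:
  fixes A :: "'a::{field,finite} mat"
  assumes A: "A \<in> carrier_mat n n" and v: "cyclic_vec A v"
  shows "krylov_mat A v \<in> inj_mats n n"
proof -
  note bij = cyclic_vec_minimal_poly(1)[OF A v]
  have "c = 0\<^sub>v n" if c: "c \<in> carrier_vec n" "krylov_mat A v *\<^sub>v c = 0\<^sub>v n" for c
  proof -
    obtain p where p: "p \<in> poly_lt n" "c = vec n (coeff p)" using exists_poly_with_coeffs[OF c(1)] by blast
    then have "poly_act A p v = poly_act A 0 v" using krylov_mat_mult_vec[OF A p(1)] c(2) A by simp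
    moreover have "0 \<in> poly_lt n" by (simp add: poly_lt_def)
    ultimately have "p = 0" using bij p(1) unfolding bij_betw_def inj_on_def by blast
    then show ?thesis using p(2) by auto
  qed
  then show ?thesis using A by (auto simp: inj_mats_def krylov_mat_def)
qed

lemma mat_eq_if_mult_vec_eq:
  fixes A B :: "'a::field mat"
  assumes A: "A \<in> carrier_mat n n" and B: "B \<in> carrier_mat n n"
    and eq: "\<And>w. w \<in> carrier_vec n \<Longrightarrow> A *\<^sub>v w = B *\<^sub>v w"
  shows "A = B"
proof (rule eq_matI)
  fix i j assume "i < dim_row B" "j < dim_col B"
  then have ij: "i < n" "j < n" using B by auto
  have "(M *\<^sub>v unit_vec n j) $ i = M $$ (i,j)" if "M \<in> carrier_mat n n" for M :: "'a mat"
    using index_mult_mat_vec_sum[OF that, of "unit_vec n j" i] ij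
    by (simp add: unit_vec_def if_distrib cong: if_cong)
  then show "A $$ (i,j) = B $$ (i,j)" using A B eq[of "unit_vec n j"] by (metis unit_vec_carrier)
qed (use A B in auto)

definition cyclic_pairs :: "nat \<Rightarrow> 'a::field poly \<Rightarrow> ('a mat \<times> 'a vec) set" where
  "cyclic_pairs n f = {(A, v). A \<in> carrier_mat n n \<and> cyclic_vec A v \<and> poly_act A f v = 0\<^sub>v n}"

text \<open>The Krylov matrix fixes \<open>p v\<close> for \<open>p\<close> in
  \<open>poly_lt n\<close>, and reduction modulo the common \<open>f\<close> extends this to all
  \<open>p\<close>. Then \<open>p = 1\<close> recovers \<open>v\<close>, and passing from
  \<open>p\<close> to \<open>z p\<close> recovers \<open>A\<close>.\<close>

lemma inj_on_krylov_mat: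
  fixes f :: "'a::{field,finite} poly"
  assumes f: "f \<in> monics n"
  shows "inj_on (\<lambda>(A, v). krylov_mat A v) (cyclic_pairs n f)"
proof (rule inj_onI, clarify)
  fix A B :: "'a mat" and v w
  assume Av: "(A, v) \<in> cyclic_pairs n f" and Bw: "(B, w) \<in> cyclic_pairs n f"
    and eq: "krylov_mat A v = krylov_mat B w"
  have A: "A \<in> carrier_mat n n" "cyclic_vec A v" "poly_act A f v = 0\<^sub>v n"
    and B: "B \<in> carrier_mat n n" "cyclic_vec B w" "poly_act B f w = 0\<^sub>v n"
    using Av Bw by (auto simp: cyclic_pairs_def)
  have vc: "v \<in> carrier_vec n" "w \<in> carrier_vec n" using A B by (auto simp: cyclic_vec_def)
  have fn: "f \<noteq> 0" "degree f = n" using monicsD[OF f] by auto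
  have red: "poly_act C p u = poly_act C (p mod f) u"
    if C: "C \<in> carrier_mat n n" "u \<in> carrier_vec n" "poly_act C f u = 0\<^sub>v n" for C u p
  proof -
    have "p - p mod f = p div f * f" by (simp add: minus_mod_eq_div_mult)
    then have "poly_act C (p - p mod f) u = 0\<^sub>v n" using poly_act_eq_0_mult(1)[OF C] by simp
    then show ?thesis using poly_act_diff_eq_0_iff[OF C(1)] by blast
  qed
  have act: "poly_act A p v = poly_act B p w" for p
  proof -
    have "p mod f \<in> poly_lt n" using mod_in_poly_lt[OF fn(1)] fn(2) by simp
    then have "poly_act A (p mod f) v = poly_act B (p mod f) w"
      using krylov_mat_mult_vec[OF A(1)] krylov_mat_mult_vec[OF B(1)] eq by metis
    then show ?thesis using red[OF A(1) vc(1) A(3)] red[OF B(1) vc(2) B(3)] by metis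
  qed
  have "v = w" using act[of 1] A B vc by simp
  moreover have "A = B"
  proof (rule mat_eq_if_mult_vec_eq[OF A(1) B(1)])
    fix u :: "'a vec" assume u: "u \<in> carrier_vec n"
    then obtain p where p: "u = poly_act A p v" using A by (auto simp: cyclic_vec_def)
    \<comment> \<open>Applying the matrix is the action of \<open>z\<close>, and
      \<open>pCons 0 p\<close> is \<open>z p\<close>.\<close>
    have shift: "C *\<^sub>v poly_act C p x = poly_act C (pCons 0 p) x"
      if "C \<in> carrier_mat n n" "x \<in> carrier_vec n" for C :: "'a mat" and x
      using poly_act_pCons[OF that, of 0 p] that mult_mat_vec_carrier[OF that(1) poly_act_carrier[OF that(1), of p x]]
      by auto
    have "A *\<^sub>v u = poly_act A (pCons 0 p) v" unfolding p using shift[OF A(1) vc(1)] .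
    also have "\<dots> = poly_act B (pCons 0 p) w" by (rule act)
    also have "\<dots> = B *\<^sub>v poly_act B p w" using shift[OF B(1) vc(2)] by simp
    also have "poly_act B p w = u" using act[of p] p by simp
    finally show "A *\<^sub>v u = B *\<^sub>v u" .
  qed
  ultimately show "A = B \<and> v = w" by simp
qed

text \<open>For \<open>f\<close> in \<open>monics n\<close>, multiplication by \<open>z\<close> on
  \<open>F[z]/(f)\<close> in the basis of powers of \<open>z\<close>. The last column is
  \<open>z ^ n\<close> modulo \<open>f\<close>, the negated lower coefficients of
  \<open>f\<close>.\<close>

definition companion_mat :: "nat \<Rightarrow> 'a::field poly \<Rightarrow> 'a mat" where
  "companion_mat n f = mat n n (\<lambda>(i,j). (if i = Suc j then 1 else 0) - (if Suc j = n then coeff f i else 0))"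

lemma companion_mat_mult_vec:
  fixes f :: "'a::field poly"
  assumes f: "f \<in> monics n" and p: "p \<in> poly_lt n"
  shows "companion_mat n f *\<^sub>v vec n (coeff p) = vec n (coeff (pCons 0 p mod f))"
proof (cases n)
  case 0
  then show ?thesis by (auto simp: companion_mat_def)
next
  case (Suc m)
  have C: "companion_mat n f \<in> carrier_mat n n" by (simp add: companion_mat_def)
  have fn: "degree f = n" "lead_coeff f = 1" "f \<noteq> 0" using monicsD[OF f] by auto
  \<comment> \<open>As \<open>n = Suc m\<close>, \<open>coeff p m\<close> is the coefficient of
    \<open>z ^ n\<close> in \<open>z p\<close>; subtracting that multiple of the monic
    \<open>f\<close> leaves the remainder.\<close>
  define r where "r = pCons 0 p - smult (coeff p m) f"
  have cr: "coeff r i = (if i = 0 then 0 else coeff p (i - 1)) - coeff p m * coeff f i" for i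
    by (simp add: r_def coeff_pCons split: nat.split)
  have "coeff r i = 0" if "n \<le> i" for i
  proof (cases "i = n")
    case True
    then show ?thesis using Suc fn by (simp add: cr)
  next
    case False
    then have "coeff p (i - 1) = 0" "coeff f i = 0" using p that fn by (auto simp: poly_lt_def coeff_eq_0)
    then show ?thesis by (simp add: cr)
  qed
  then have "r \<in> poly_lt (degree f)" using fn by (simp add: poly_lt_def)
  then have "r mod f = r" by (rule mod_poly_lt)
  moreover have "f dvd pCons 0 p - r" by (simp add: r_def dvd_smult)
  ultimately have r: "pCons 0 p mod f = r" by (metis mod_eq_dvd_iff)
  show ?thesis
  proof (rule eq_vecI)
    fix i assume "i < dim_vec (vec n (coeff (pCons 0 p mod f)))"
    then have i: "i < n" by simp
    have "(companion_mat n f *\<^sub>v vec n (coeff p)) $ i =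
        (\<Sum>j<n. (if i = Suc j then coeff p j else 0) - (if Suc j = n then coeff f i * coeff p j else 0))"
      using index_mult_mat_vec_sum[OF C, of "vec n (coeff p)" i] i
      by (auto simp: companion_mat_def left_diff_distrib intro!: sum.cong)
    also have "\<dots> = (\<Sum>j<n. if i = Suc j then coeff p j else 0) - (\<Sum>j<n. if Suc j = n then coeff f i * coeff p j else 0)"
      by (rule sum_subtractf)
    also have "(\<Sum>j<n. if Suc j = n then coeff f i * coeff p j else 0) = coeff f i * coeff p m"
      using Suc by simp
    also have "(\<Sum>j<n. if i = Suc j then coeff p j else 0) = (if i = 0 then 0 else coeff p (i - 1))"
      using i by (cases i) auto
    finally show "(companion_mat n f *\<^sub>v vec n (coeff p)) $ i = vec n (coeff (pCons 0 p mod f)) $ i"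
      using i r cr by (simp add: mult.commute)
  qed (use C in simp)
qed

text \<open>
  Columns of \<open>P\<close> are the images of \<open>1, z, z\<^sup>2, \<dots>\<close> under a linear isomorphism from \<open>F[z]/(f)\<close>; \<open>A\<close> is
  multiplication by \<open>z\<close> transported along it.
\<close>

lemma krylov_mat_surj:
  fixes f :: "'a::{field,finite} poly"
  assumes f: "f \<in> monics n" and P: "P \<in> inj_mats n n"
  shows "\<exists>(A, v)\<in>cyclic_pairs n f. krylov_mat A v = P"
proof -
  have Pc: "P \<in> carrier_mat n n" using P by (simp add: inj_mats_def)
  obtain Q where Q: "Q \<in> carrier_mat n n" "Q * P = 1\<^sub>m n" "P * Q = 1\<^sub>m n"
    using inj_mats_square_inverse[OF P] by blast
  have fn: "degree f = n" "f \<noteq> 0" using monicsD[OF f] by auto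
  define C where "C = companion_mat n f"
  have C: "C \<in> carrier_mat n n" by (simp add: C_def companion_mat_def)
  \<comment> \<open>Coordinates of the class of \<open>p\<close> modulo \<open>f\<close>, defined
    for all \<open>p\<close> so that the action can be followed by induction on
    \<open>p\<close>.\<close>
  define cv where "cv = (\<lambda>p :: 'a poly. vec n (coeff (p mod f)))"
  have cv: "cv p \<in> carrier_vec n" for p by (simp add: cv_def)
  define A where "A = P * (C * Q)"
  define v where "v = P *\<^sub>v cv 1"
  have A: "A \<in> carrier_mat n n" using Pc C Q by (simp add: A_def)
  have v: "v \<in> carrier_vec n" using mult_mat_vec_carrier[OF Pc cv] by (simp add: v_def)
  have AP: "A *\<^sub>v (P *\<^sub>v c) = P *\<^sub>v (C *\<^sub>v c)" if c: "c \<in> carrier_vec n" for c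
  proof -
    have "A *\<^sub>v (P *\<^sub>v c) = P *\<^sub>v (C *\<^sub>v (Q *\<^sub>v (P *\<^sub>v c)))"
      using Pc C Q(1) c unfolding A_def by (simp add: assoc_mult_mat_vec[of _ n n _ n])
    also have "Q *\<^sub>v (P *\<^sub>v c) = c"
      using assoc_mult_mat_vec[OF Q(1) Pc c] Q(2) c by simp
    finally show ?thesis .
  qed
  \<comment> \<open>Horner's scheme on both sides: multiplication by \<open>z\<close> is
    \<open>A\<close> on vectors and \<open>C\<close> on coordinates.\<close>
  have act: "poly_act A p v = P *\<^sub>v cv p" for p
  proof (induction p)
    case 0
    have "cv 0 = 0\<^sub>v n" by (auto simp: cv_def)
    then show ?case using A Pc by (auto simp: mult_mat_vec_def)
  next
    case (pCons a p)
    have pm: "p mod f \<in> poly_lt n" using mod_in_poly_lt[OF fn(2)] fn(1) by simp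
    have "pCons a p mod f = smult a (1 mod f) + pCons 0 (p mod f) mod f"
    proof -
      have "pCons a p = smult a 1 + pCons 0 p" by simp
      moreover have "pCons 0 (p mod f) mod f = pCons 0 p mod f"
        using mod_mult_right_eq[of "[:0, 1:]" p f] by simp
      ultimately show ?thesis by (metis mod_smult_left poly_mod_add_left)
    qed
    then have eq: "cv (pCons a p) = a \<cdot>\<^sub>v cv 1 + C *\<^sub>v cv p"
      unfolding C_def cv_def companion_mat_mult_vec[OF f pm] by auto
    have "poly_act A (pCons a p) v = a \<cdot>\<^sub>v v + A *\<^sub>v (P *\<^sub>v cv p)"
      using poly_act_pCons[OF A v] pCons by simp
    also have "\<dots> = P *\<^sub>v (a \<cdot>\<^sub>v cv 1) + P *\<^sub>v (C *\<^sub>v cv p)"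
      unfolding AP[OF cv] v_def using mult_mat_vec[OF Pc cv] by simp
    also have "\<dots> = P *\<^sub>v cv (pCons a p)"
      unfolding eq by (rule mult_add_distrib_mat_vec[symmetric, OF Pc]) (use C cv in auto)
    finally show ?case .
  qed
  have act': "poly_act A p v = P *\<^sub>v vec n (coeff p)" if "p \<in> poly_lt n" for p
    using act[of p] mod_poly_lt[of p f] that fn by (simp add: cv_def)
  have "\<exists>p. w = poly_act A p v" if w: "w \<in> carrier_vec n" for w
  proof -
    obtain p where p: "p \<in> poly_lt n" "Q *\<^sub>v w = vec n (coeff p)"
      using exists_poly_with_coeffs[of "Q *\<^sub>v w" n] mult_mat_vec_carrier[OF Q(1) w] by blast
    have "poly_act A p v = P *\<^sub>v (Q *\<^sub>v w)" using act'[OF p(1)] p(2) by simp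
    also have "\<dots> = w" using assoc_mult_mat_vec[OF Pc Q(1) w] Q(3) w by simp
    finally show ?thesis by blast
  qed
  then have cyc: "cyclic_vec A v" using A v by (auto simp: cyclic_vec_def)
  have "cv f = cv 0" by (simp add: cv_def)
  then have "poly_act A f v = 0\<^sub>v n" using act[of f] act[of 0] A by simp
  with cyc A have mem: "(A, v) \<in> cyclic_pairs n f" by (simp add: cyclic_pairs_def)
  have "krylov_mat A v = P"
  proof (rule mat_eq_if_mult_vec_eq[OF _ Pc])
    show "krylov_mat A v \<in> carrier_mat n n" using A by (auto simp: krylov_mat_def)
    fix w :: "'a vec" assume "w \<in> carrier_vec n"
    then obtain p where "p \<in> poly_lt n" "w = vec n (coeff p)" using exists_poly_with_coeffs by blast
    then show "krylov_mat A v *\<^sub>v w = P *\<^sub>v w" using krylov_mat_mult_vec[OF A] act' by simp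
  qed
  with mem show ?thesis by blast
qed

lemma card_cyclic_pairs:
  fixes f :: "'a::{field,finite} poly"
  assumes f: "f \<in> monics n"
  shows "card (cyclic_pairs n f) = card (inj_mats n n :: 'a mat set)"
proof -
  have "(\<lambda>(A, v). krylov_mat A v) ` cyclic_pairs n f = inj_mats n n"
  proof (intro equalityI subsetI)
    fix P assume "P \<in> (\<lambda>(A, v). krylov_mat A v) ` cyclic_pairs n f"
    then show "P \<in> inj_mats n n" using krylov_mat_inj_mats by (auto simp: cyclic_pairs_def)
  next
    fix P :: "'a mat" assume "P \<in> inj_mats n n"
    from krylov_mat_surj[OF f this] show "P \<in> (\<lambda>(A, v). krylov_mat A v) ` cyclic_pairs n f" by force
  qed
  then show ?thesis using card_image[OF inj_on_krylov_mat[OF f]] by simp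
qed

section \<open>Counting matrices by minimal polynomial\<close>

lemma card_carrier_mat:
  "finite (carrier_mat n m :: 'a::{zero,finite} mat set) \<and> card (carrier_mat n m :: 'a mat set) = CARD('a) ^ (n * m)"
proof -
  let ?E = "PiE ({..<n} \<times> {..<m}) (\<lambda>_. UNIV :: 'a set)"
  have bij: "bij_betw (\<lambda>M. \<lambda>ij\<in>{..<n}\<times>{..<m}. M $$ ij) (carrier_mat n m) ?E"
    by (rule bij_betw_byWitness[where f' = "mat n m"]) (auto simp: fun_eq_iff PiE_def extensional_def)
  then show ?thesis
    using bij_betw_finite[OF bij] bij_betw_same_card[OF bij] card_PiE[of "{..<n} \<times> {..<m}" "\<lambda>_. UNIV :: 'a set"]
      finite_PiE[of "{..<n} \<times> {..<m}" "\<lambda>_. UNIV :: 'a set"] by (simp add: card_cartesian_product)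
qed

text \<open>Double counting of \<open>cyclic_pairs n f\<close>: Krylov matrices give the order of
  the general linear group, and each matrix in \<open>R f\<close> contributes
  \<open>\<Phi>(f)\<close> vectors. The sets \<open>R f\<close> partition the regular
  matrices.\<close>

lemma card_regular_mats:
  "real (card {A \<in> (carrier_mat n n :: 'a::{field,finite} mat set). regular_mat A}) =
    real (card (inj_mats n n :: 'a mat set)) *
    (\<Sum>f\<in>(monics n :: 'a poly set). 1 / real (card {r\<in>poly_lt n. coprime r f}))"
proof -
  define R where "R = (\<lambda>f::'a poly. {A\<in>carrier_mat n n. \<exists>v. cyclic_vec A v \<and> poly_act A f v = 0\<^sub>v n})"
  have finR: "finite (R f)" for f using card_carrier_mat[of n n, where 'a='a] by (simp add: R_def)
  \<comment> \<open>The identity makes this count nonzero; the totient, a divisor of it, is then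
    nonzero too and can be divided by.\<close>
  have "1\<^sub>m n \<in> (inj_mats n n :: 'a mat set)" by (auto simp: inj_mats_def)
  then have GL: "card (inj_mats n n :: 'a mat set) \<noteq> 0" using card_inj_mats[of n n, where 'a='a] by auto
  have cR: "real (card (R f)) = real (card (inj_mats n n :: 'a mat set)) * (1 / real (card {r\<in>poly_lt n. coprime r f}))"
    if f: "f \<in> monics n" for f
  proof -
    have "cyclic_pairs n f = (SIGMA A : R f. {w. cyclic_vec A w \<and> poly_act A f w = 0\<^sub>v n})"
      by (auto simp: cyclic_pairs_def R_def)
    moreover have "finite {w. cyclic_vec A w \<and> poly_act A f w = 0\<^sub>v n}" if "A \<in> R f" for A
      using that by (intro finite_subset[OF _ finite_carrier_vec[of n]]) (auto simp: R_def cyclic_vec_def)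
    ultimately have "card (cyclic_pairs n f) = (\<Sum>A\<in>R f. card {w. cyclic_vec A w \<and> poly_act A f w = 0\<^sub>v n})"
      using finR by (simp add: card_SigmaI)
    also have "\<dots> = (\<Sum>A\<in>R f. card {r\<in>poly_lt n. coprime r f})"
      using card_cyclic_vecs f by (intro sum.cong) (auto simp: R_def)
    finally have "card (inj_mats n n :: 'a mat set) = card (R f) * card {r\<in>poly_lt n. coprime r f}"
      using card_cyclic_pairs[OF f] by simp
    moreover from this have "card {r\<in>poly_lt n. coprime r f} \<noteq> 0" using GL by (metis mult_0_right)
    ultimately show ?thesis by simp
  qed
  have "{A \<in> carrier_mat n n. regular_mat A} = (\<Union>f\<in>monics n. R f)"
  proof (intro equalityI subsetI)
    fix A :: "'a mat" assume "A \<in> {A \<in> carrier_mat n n. regular_mat A}"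
    then have A: "A \<in> carrier_mat n n" "regular_mat A" by auto
    then obtain v where v: "cyclic_vec A v" using regular_imp_cyclic_vec by blast
    from cyclic_vec_minimal_poly(2)[OF A(1) v] obtain f where "f \<in> monics n" "poly_act A f v = 0\<^sub>v n"
      by blast
    with A v show "A \<in> (\<Union>f\<in>monics n. R f)" by (auto simp: R_def)
  qed (auto simp: R_def intro: cyclic_vec_imp_regular)
  \<comment> \<open>With \<open>v = p w\<close>, an annihilator \<open>g\<close> of \<open>w\<close>
    also kills \<open>v\<close>, so \<open>f\<close> divides \<open>g\<close>; equal degrees and
    leading coefficients then force \<open>f = g\<close>.\<close>
  moreover have "R f \<inter> R g = {}" if fg: "f \<in> monics n" "g \<in> monics n" "f \<noteq> g" for f g
  proof (rule ccontr)
    assume "R f \<inter> R g \<noteq> {}"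
    then obtain A v w where A: "A \<in> carrier_mat n n" and v: "cyclic_vec A v" "poly_act A f v = 0\<^sub>v n"
      and w: "cyclic_vec A w" "poly_act A g w = 0\<^sub>v n" by (auto simp: R_def)
    have vw: "v \<in> carrier_vec n" "w \<in> carrier_vec n" using v w A by (auto simp: cyclic_vec_def)
    then obtain p where "v = poly_act A p w" using w A by (auto simp: cyclic_vec_def)
    then have "poly_act A g v = 0\<^sub>v n" using poly_act_eq_0_mult(2)[OF A vw(2) w(2)] by simp
    then have "f dvd g" using cyclic_vec_minimal_poly(3)[OF A v(1) fg(1) v(2)] by simp
    then have "f dvd g - f" by simp
    moreover have "g - f \<in> poly_lt n" using fg(1,2) by (auto simp: poly_lt_def monics_eq)
    ultimately have "g - f = 0" using dvd_poly_lt_imp_0 monicsD[OF fg(1)] by blast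
    then show False using fg(3) by simp
  qed
  ultimately have "card {A \<in> (carrier_mat n n :: 'a mat set). regular_mat A} = (\<Sum>f\<in>monics n. card (R f))"
    using card_UN_disjoint[of "monics n" R] card_monics(1)[of n] finR by simp
  then have "real (card {A \<in> (carrier_mat n n :: 'a mat set). regular_mat A}) = (\<Sum>f\<in>monics n. real (card (R f)))"
    by simp
  also have "\<dots> = (\<Sum>f\<in>(monics n :: 'a poly set). real (card (inj_mats n n :: 'a mat set)) * (1 / real (card {r\<in>poly_lt n. coprime r f})))"
    using cR by (intro sum.cong) auto
  finally show ?thesis by (simp add: sum_distrib_left)
qed

section \<open>Limits of the products\<close>

lemma tendsto_partial_products:
  fixes q :: real
  assumes "q > 1"
  shows "(\<lambda>n. \<Prod>i<n. 1 - 1 / q ^ Suc i) \<longlonglongrightarrow>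
    (1 - 1 / q) * (1 - 1 / q ^ 2) * (\<Prod>r. 1 - 1 / q ^ (r + 3))"
proof -
  \<comment> \<open>Summability of a geometric series gives convergence of the infinite
    product.\<close>
  have "summable (\<lambda>r. (1 / q) ^ 3 * (1 / q) ^ r)"
    using assms by (intro summable_mult summable_geometric) simp
  then have "summable (\<lambda>r. norm (- ((1 / q) ^ (r + 3))))"
    using assms by (simp add: power_add mult.commute abs_mult)
  then have "abs_convergent_prod (\<lambda>r. 1 + (- ((1 / q) ^ (r + 3))))"
    by (intro summable_imp_abs_convergent_prod) simp
  then have "convergent_prod (\<lambda>r. 1 - 1 / q ^ (r + 3))"
    by (simp add: abs_convergent_prod_imp_convergent_prod power_divide)
  then have "(\<lambda>n. \<Prod>i\<le>n. 1 - 1 / q ^ (i + 3)) \<longlonglongrightarrow> (\<Prod>r. 1 - 1 / q ^ (r + 3))"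
    by (rule convergent_prod_LIMSEQ)
  then have "(\<lambda>n. (1 - 1 / q) * (1 - 1 / q ^ 2) * (\<Prod>i\<le>n. 1 - 1 / q ^ (i + 3)))
      \<longlonglongrightarrow> (1 - 1 / q) * (1 - 1 / q ^ 2) * (\<Prod>r. 1 - 1 / q ^ (r + 3))"
    by (intro tendsto_intros)
  \<comment> \<open>The exponents \<open>i + 3\<close> for \<open>i \<le> n\<close> run from
    \<open>3\<close> to \<open>n + 3\<close>; the two extra factors supply the exponents
    \<open>1\<close> and \<open>2\<close>.\<close>
  moreover have "(1 - 1 / q) * (1 - 1 / q ^ 2) * (\<Prod>i\<le>n. 1 - 1 / q ^ (i + 3)) = (\<Prod>i<n + 3. 1 - 1 / q ^ Suc i)" for n
    by (induction n) (simp_all add: eval_nat_numeral mult_ac)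
  ultimately have "(\<lambda>n. \<Prod>i<n + 3. 1 - 1 / q ^ Suc i) \<longlonglongrightarrow>
    (1 - 1 / q) * (1 - 1 / q ^ 2) * (\<Prod>r. 1 - 1 / q ^ (r + 3))" by simp
  then show ?thesis by (rule LIMSEQ_offset)
qed

theorem theorem6:
  fixes q :: nat
  assumes "q = CARD('a::{field, finite})"
  shows "(\<lambda>n. measure_pmf.prob (pmf_of_set (carrier_mat n n :: 'a mat set))
                {A \<in> carrier_mat n n. regular_mat A})
           \<longlonglongrightarrow> (1 - 1 / real q ^ 5) * (\<Prod>r. 1 - 1 / real q ^ (r + 3))"
proof -
  define Q where "Q = real q"
  have Q: "Q > 1" "Q = real CARD('a)" using CARD_field_gt_1[where 'a='a] assms by (simp_all add: Q_def)
  let ?a = "\<lambda>n. \<Sum>f\<in>(monics n :: 'a poly set). 1 / real (card {r\<in>poly_lt n. coprime r f})"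
  have "measure_pmf.prob (pmf_of_set (carrier_mat n n :: 'a mat set)) {A \<in> carrier_mat n n. regular_mat A} =
      (\<Prod>i<n. 1 - 1 / Q ^ Suc i) * ?a n" for n
  proof -
    have ne: "(carrier_mat n n :: 'a mat set) \<noteq> {}" by (metis empty_iff zero_carrier_mat)
    have "carrier_mat n n \<inter> {A \<in> carrier_mat n n. regular_mat A} = {A \<in> (carrier_mat n n :: 'a mat set). regular_mat A}"
      by auto
    then have "measure_pmf.prob (pmf_of_set (carrier_mat n n :: 'a mat set)) {A \<in> carrier_mat n n. regular_mat A} =
        real (card {A \<in> (carrier_mat n n :: 'a mat set). regular_mat A}) / Q ^ (n * n)"
      using measure_pmf_of_set[OF ne] card_carrier_mat[of n n, where 'a='a] by (simp add: Q(2))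
    \<comment> \<open>The number \<open>Q ^ (n * n)\<close> of all matrices is written as
      \<open>n\<close> factors \<open>Q ^ n\<close>, one for each factor of the order of the general
      linear group.\<close>
    also have "\<dots> = (\<Prod>i<n. Q ^ n - Q ^ i) / (\<Prod>i<n. Q ^ n) * ?a n"
      unfolding card_regular_mats using card_inj_mats[of n n, where 'a='a] by (simp add: Q(2) power_mult)
    \<comment> \<open>Reversing the index makes the factors after division independent of
      \<open>n\<close>.\<close>
    also have "(\<Prod>i<n. Q ^ n - Q ^ i) = (\<Prod>i<n. Q ^ n - Q ^ (n - Suc i))"
      by (rule prod.nat_diff_reindex[symmetric])
    also have "\<dots> / (\<Prod>i<n. Q ^ n) = (\<Prod>i<n. (Q ^ n - Q ^ (n - Suc i)) / Q ^ n)"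
      by (rule prod_dividef[symmetric])
    also have "\<dots> = (\<Prod>i<n. 1 - 1 / Q ^ Suc i)"
      using Q(1) by (intro prod.cong) (auto simp: diff_divide_distrib power_diff)
    finally show ?thesis .
  qed
  moreover have "(\<lambda>n. (\<Prod>i<n. 1 - 1 / Q ^ Suc i) * ?a n) \<longlonglongrightarrow>
      ((1 - 1 / Q) * (1 - 1 / Q ^ 2) * (\<Prod>r. 1 - 1 / Q ^ (r + 3))) *
      ((1 - 1 / Q ^ 5) / ((1 - 1 / Q) * (1 - 1 / Q ^ 2)))"
    using tendsto_partial_products[OF Q(1)] tendsto_sum_inverse_totient[where 'a='a]
    unfolding Q(2) by (rule tendsto_mult)
  \<comment> \<open>The factors with exponents \<open>1\<close> and \<open>2\<close> cancel between
    the two limits; they are nonzero because \<open>Q > 1\<close>.\<close>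
  moreover {
    have "1 - 1 / Q \<noteq> 0" "1 - 1 / Q ^ 2 \<noteq> 0"
    using Q(1) one_less_power[OF Q(1), of 2] by (simp_all add: less_imp_neq[symmetric])
    moreover have "(a * b * c) * (d / (a * b)) = d * c" if "a \<noteq> 0" "b \<noteq> 0" for a b c d :: real
      using that by simp
    ultimately have "((1 - 1 / Q) * (1 - 1 / Q ^ 2) * (\<Prod>r. 1 - 1 / Q ^ (r + 3))) *
      ((1 - 1 / Q ^ 5) / ((1 - 1 / Q) * (1 - 1 / Q ^ 2))) =
      (1 - 1 / Q ^ 5) * (\<Prod>r. 1 - 1 / Q ^ (r + 3))"
      by blast
  }
  ultimately show ?thesis unfolding Q_def by (simp only:)
qed

end
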